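(* Let $I$ be a directed set and let $\mathfrak{F}\equiv(X_i,\mathcal{B}_i,\mu_i,\pi_{ij})$ be a convergent diagram in $\mathfrak{M}$ indexed by $I$, with limit $(X_\infty,\mathcal{B}_\infty,\mu_\infty,\pi_i)$. Then for each $1\le p<\infty$ the space $L^p(X_\infty,\mu_\infty)$ is isometrically isomorphic to $\mathscr{L}^p(\mathfrak{F})$.
   Context: A directed set is a nonempty set $I$ with a reflexive and transitive relation $\le$ such that any two elements have a common upper bound. $\mathfrak{M}$ is the category of probability spaces and measure preserving measurable maps. A diagram in $\mathfrak{M}$ indexed by $I$ is a family $(X_i,\mathcal{B}_i,\mu_i,\pi_{ij})$ of probability spaces and measure preserving maps $\pi_{ij}:X_j\to X_i$ for $i\le j$ (i.e. $(\pi_{ij})_*\mu_j=\mu_i$), with $\pi_{ii}=\mathrm{id}$ and $\pi_{ik}=\pi_{ij}\circ\pi_{jk}$ for $i\le j\le k$. Put $X_\infty=\{(x_i)_{i}\in\prod_{i\in I}X_i:\pi_{ij}(x_j)=x_i\text{ for all }i\le j\}$, let $\pi_j:X_\infty\to X_j$ be the coordinate projections, and $\mathcal{B}_\infty=\sigma(\{\pi_i^{-1}(B):B\in\mathcal{B}_i,\ i\in I\})$. The diagram is convergent if there is a measure $\mu_\infty$ on $(X_\infty,\mathcal{B}_\infty)$ with $(\pi_i)_*\mu_\infty=\mu_i$ for every $i$; then $(X_\infty,\mathcal{B}_\infty,\mu_\infty,\pi_i)$ is its limit. $L^p$ denotes spaces of real-valued functions, and $\pi_{ij}^*(u)=u\circ\pi_{ij}$.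 A family $(f_i)_{i\in I}\in\prod_{i\in I}L^p(X_i,\mu_i)$ is co-Cauchy if for every $\varepsilon>0$ there is $\ell\in I$ with $\|\pi_{ij}^*(f_i)-f_j\|_{L^p(\mu_j)}<\varepsilon$ for all $i,j\in I$ with $\ell\le i\le j$. The space $\mathscr{L}^p(\mathfrak{F})$ is the vector space of co-Cauchy families modulo the relation $(f_i)\sim(g_i)$ iff $\lim_{i\in I}\|f_i-g_i\|_{L^p(\mu_i)}=0$ (net limit), with norm $\|(f_i)_{i\in I}\|_{\mathscr{L}}=\lim_{i\in I}\|f_i\|_{L^p(\mu_i)}$ (net limit, which exists). *)

theory Defs
  imports "HOL-Probability.Probability_Measure" "HOL-Algebra.Module"
begin

section \<open>Real normed spaces with explicit carrier\<close>

definition real_ring :: "real ring"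
  where "real_ring = \<lparr>carrier = UNIV, mult = (*), one = 1, zero = 0, add = (+)\<rparr>"

text \<open>
  The record of modules in HOL-Algebra extends the record of rings. The fields \<open>mult\<close> and
  \<open>one\<close> play no role for a module, and are left undefined in every space constructed below.
\<close>

record 'v normed = "(real, 'v) module" +
  nrm :: "'v \<Rightarrow> real"

locale real_normed_space = Module.module real_ring V for V :: "'v normed" (structure) +
  assumes nrm_eq_zero_iff: "x \<in> carrier V \<Longrightarrow> nrm V x = 0 \<longleftrightarrow> x = \<zero>\<^bsub>V\<^esub>"
    and nrm_smult: "x \<in> carrier V \<Longrightarrow> nrm V (c \<odot>\<^bsub>V\<^esub> x) = \<bar>c\<bar> * nrm V x"
    and nrm_triangle: "x \<in> carrier V \<Longrightarrow> y \<in> carrier V \<Longrightarrow>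
      nrm V (x \<oplus>\<^bsub>V\<^esub> y) \<le> nrm V x + nrm V y"

definition isometric_isomorphism :: "'v normed \<Rightarrow> 'w normed \<Rightarrow> ('v \<Rightarrow> 'w) \<Rightarrow> bool"
  where "isometric_isomorphism V W T \<longleftrightarrow>
    bij_betw T (carrier V) (carrier W) \<and>
    (\<forall>x\<in>carrier V. \<forall>y\<in>carrier V. T (x \<oplus>\<^bsub>V\<^esub> y) = T x \<oplus>\<^bsub>W\<^esub> T y) \<and>
    (\<forall>c. \<forall>x\<in>carrier V. T (c \<odot>\<^bsub>V\<^esub> x) = c \<odot>\<^bsub>W\<^esub> T x) \<and>
    (\<forall>x\<in>carrier V. nrm W (T x) = nrm V x)"

definition isometrically_isomorphic :: "'v normed \<Rightarrow> 'w normed \<Rightarrow> bool"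
  where "isometrically_isomorphic V W \<longleftrightarrow>
    real_normed_space V \<and> real_normed_space W \<and> (\<exists>T. isometric_isomorphism V W T)"

text \<open>
  The quotient of a seminormed space by an equivalence relation \<open>R\<close> on its carrier that is
  compatible with the operations and the seminorm; the operations are computed on
  representatives.
\<close>

definition quotient_space :: "'v normed \<Rightarrow> ('v \<times> 'v) set \<Rightarrow> 'v set normed"
  where "quotient_space V R =
    \<lparr>carrier = carrier V // R,
     mult = undefined, one = undefined,
     zero = R `` {\<zero>\<^bsub>V\<^esub>},
     add = (\<lambda>A B. \<Union>a\<in>A. \<Union>b\<in>B. R `` {a \<oplus>\<^bsub>V\<^esub> b}),
     smult = (\<lambda>c A. \<Union>a\<in>A. R `` {c \<odot>\<^bsub>V\<^esub> a}),
     nrm = (\<lambda>A. the_elem (nrm V ` A))\<rparr>"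


section \<open>The spaces $L^p$\<close>

definition Lp_functions :: "'a measure \<Rightarrow> real \<Rightarrow> ('a \<Rightarrow> real) normed"
  where "Lp_functions M p =
    \<lparr>carrier = {u \<in> borel_measurable M. integrable M (\<lambda>x. \<bar>u x\<bar> powr p)},
     mult = undefined, one = undefined,
     zero = (\<lambda>x. 0),
     add = (\<lambda>u v x. u x + v x),
     smult = (\<lambda>c u x. c * u x),
     nrm = (\<lambda>u. (\<integral>x. \<bar>u x\<bar> powr p \<partial>M) powr (1 / p))\<rparr>"

definition ae_eq_rel :: "'a measure \<Rightarrow> real \<Rightarrow> (('a \<Rightarrow> real) \<times> ('a \<Rightarrow> real)) set"
  where "ae_eq_rel M p =
    {(u, v). u \<in> carrier (Lp_functions M p) \<and> v \<in> carrier (Lp_functions M p) \<and>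
      (AE x in M. u x = v x)}"

definition Lp :: "'a measure \<Rightarrow> real \<Rightarrow> ('a \<Rightarrow> real) set normed"
  where "Lp M p = quotient_space (Lp_functions M p) (ae_eq_rel M p)"

definition pullback ::
    "'a measure \<Rightarrow> real \<Rightarrow> ('a \<Rightarrow> 'b) \<Rightarrow> ('b \<Rightarrow> real) set \<Rightarrow> ('a \<Rightarrow> real) set"
  where "pullback M p \<phi> U = (\<Union>u\<in>U. ae_eq_rel M p `` {u \<circ> \<phi>})"


section \<open>Directed sets and net limits\<close>

locale directed_set =
  fixes I :: "'i set" and leq :: "'i \<Rightarrow> 'i \<Rightarrow> bool"
  assumes nonempty: "I \<noteq> {}"
    and refl: "reflp_on I leq"
    and trans: "transp_on I leq"
    and directed: "\<lbrakk>i \<in> I; j \<in> I\<rbrakk> \<Longrightarrow> \<exists>k\<in>I. leq i k \<and> leq j k"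

definition net :: "'i set \<Rightarrow> ('i \<Rightarrow> 'i \<Rightarrow> bool) \<Rightarrow> 'i filter"
  where "net I leq = (INF i\<in>I. principal {j \<in> I. leq i j})"

lemma (in directed_set) eventually_net:
  "eventually P (net I leq) \<longleftrightarrow> (\<exists>i\<in>I. \<forall>j\<in>I. leq i j \<longrightarrow> P j)"
proof -
  have "\<exists>k\<in>I. principal {l \<in> I. leq k l} \<le>
      inf (principal {l \<in> I. leq i l}) (principal {l \<in> I. leq j l})"
    if "i \<in> I" "j \<in> I" for i j
  proof -
    from directed[OF that] obtain k where "k \<in> I" "leq i k" "leq j k" by blast
    with that show ?thesis
      by (intro bexI[of _ k]) (auto dest: transp_onD[OF trans])
  qed
  then have "eventually P (net I leq) \<longleftrightarrow>
      (\<exists>i\<in>I. eventually P (principal {j \<in> I. leq i j}))"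
    unfolding net_def by (intro eventually_INF_base nonempty) auto
  then show ?thesis
    by (auto simp: eventually_principal)
qed


section \<open>Diagrams of probability spaces and their limits\<close>

text \<open>
  Since a family of measures has a single type, all the spaces \<open>X i\<close> are carried by subsets
  of one type \<open>'a\<close>.
\<close>

locale diagram = directed_set I leq
  for I :: "'i set" and leq :: "'i \<Rightarrow> 'i \<Rightarrow> bool" +
  fixes X :: "'i \<Rightarrow> 'a measure" and \<pi> :: "'i \<Rightarrow> 'i \<Rightarrow> 'a \<Rightarrow> 'a"
  assumes prob_space: "i \<in> I \<Longrightarrow> prob_space (X i)"
    and measurable: "\<lbrakk>i \<in> I; j \<in> I; leq i j\<rbrakk> \<Longrightarrow> \<pi> i j \<in> X j \<rightarrow>\<^sub>M X i"
    and measure_preserving: "\<lbrakk>i \<in> I; j \<in> I; leq i j\<rbrakk> \<Longrightarrow> distr (X j) (X i) (\<pi> i j) = X i"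
    and map_id: "\<lbrakk>i \<in> I; x \<in> space (X i)\<rbrakk> \<Longrightarrow> \<pi> i i x = x"
    and map_comp: "\<lbrakk>i \<in> I; j \<in> I; k \<in> I; leq i j; leq j k; x \<in> space (X k)\<rbrakk> \<Longrightarrow>
      \<pi> i k x = \<pi> i j (\<pi> j k x)"

definition inverse_limit ::
    "'i set \<Rightarrow> ('i \<Rightarrow> 'i \<Rightarrow> bool) \<Rightarrow> ('i \<Rightarrow> 'a measure) \<Rightarrow> ('i \<Rightarrow> 'i \<Rightarrow> 'a \<Rightarrow> 'a) \<Rightarrow> ('i \<Rightarrow> 'a) set"
  where "inverse_limit I leq X \<pi> =
    {x \<in> (\<Pi>\<^sub>E i\<in>I. space (X i)). \<forall>i\<in>I. \<forall>j\<in>I. leq i j \<longrightarrow> \<pi> i j (x j) = x i}"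

text \<open>
  A diagram is convergent iff some \<open>M\<close> satisfies the following predicate.
\<close>

definition is_limit ::
    "'i set \<Rightarrow> ('i \<Rightarrow> 'i \<Rightarrow> bool) \<Rightarrow> ('i \<Rightarrow> 'a measure) \<Rightarrow> ('i \<Rightarrow> 'i \<Rightarrow> 'a \<Rightarrow> 'a) \<Rightarrow>
      ('i \<Rightarrow> 'a) measure \<Rightarrow> bool"
  where "is_limit I leq X \<pi> M \<longleftrightarrow>
    space M = inverse_limit I leq X \<pi> \<and>
    sets M = sigma_sets (inverse_limit I leq X \<pi>)
      {(\<lambda>x. x i) -` B \<inter> inverse_limit I leq X \<pi> | i B. i \<in> I \<and> B \<in> sets (X i)} \<and>
    (\<forall>i\<in>I. distr M (X i) (\<lambda>x. x i) = X i)"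


section \<open>Co-Cauchy families\<close>

definition co_cauchy ::
    "'i set \<Rightarrow> ('i \<Rightarrow> 'i \<Rightarrow> bool) \<Rightarrow> ('i \<Rightarrow> 'a measure) \<Rightarrow> ('i \<Rightarrow> 'i \<Rightarrow> 'a \<Rightarrow> 'a) \<Rightarrow> real \<Rightarrow>
      ('i \<Rightarrow> ('a \<Rightarrow> real) set) \<Rightarrow> bool"
  where "co_cauchy I leq X \<pi> p f \<longleftrightarrow>
    f \<in> (\<Pi>\<^sub>E i\<in>I. carrier (Lp (X i) p)) \<and>
    (\<forall>\<epsilon>>0. \<exists>l\<in>I. \<forall>i\<in>I. \<forall>j\<in>I. leq l i \<longrightarrow> leq i j \<longrightarrow>
      nrm (Lp (X j) p) (pullback (X j) p (\<pi> i j) (f i) \<ominus>\<^bsub>Lp (X j) p\<^esub> f j) < \<epsilon>)"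

definition co_cauchy_families ::
    "'i set \<Rightarrow> ('i \<Rightarrow> 'i \<Rightarrow> bool) \<Rightarrow> ('i \<Rightarrow> 'a measure) \<Rightarrow> ('i \<Rightarrow> 'i \<Rightarrow> 'a \<Rightarrow> 'a) \<Rightarrow> real \<Rightarrow>
      ('i \<Rightarrow> ('a \<Rightarrow> real) set) normed"
  where "co_cauchy_families I leq X \<pi> p =
    \<lparr>carrier = {f. co_cauchy I leq X \<pi> p f},
     mult = undefined, one = undefined,
     zero = (\<lambda>i\<in>I. \<zero>\<^bsub>Lp (X i) p\<^esub>),
     add = (\<lambda>f g. \<lambda>i\<in>I. f i \<oplus>\<^bsub>Lp (X i) p\<^esub> g i),
     smult = (\<lambda>c f. \<lambda>i\<in>I. c \<odot>\<^bsub>Lp (X i) p\<^esub> f i),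
     nrm = (\<lambda>f. Lim (net I leq) (\<lambda>i. nrm (Lp (X i) p) (f i)))\<rparr>"

definition asymptotic_rel ::
    "'i set \<Rightarrow> ('i \<Rightarrow> 'i \<Rightarrow> bool) \<Rightarrow> ('i \<Rightarrow> 'a measure) \<Rightarrow> ('i \<Rightarrow> 'i \<Rightarrow> 'a \<Rightarrow> 'a) \<Rightarrow> real \<Rightarrow>
      (('i \<Rightarrow> ('a \<Rightarrow> real) set) \<times> ('i \<Rightarrow> ('a \<Rightarrow> real) set)) set"
  where "asymptotic_rel I leq X \<pi> p =
    {(f, g). co_cauchy I leq X \<pi> p f \<and> co_cauchy I leq X \<pi> p g \<and>
      ((\<lambda>i. nrm (Lp (X i) p) (f i \<ominus>\<^bsub>Lp (X i) p\<^esub> g i)) \<longlongrightarrow> 0) (net I leq)}"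

definition LLp ::
    "'i set \<Rightarrow> ('i \<Rightarrow> 'i \<Rightarrow> bool) \<Rightarrow> ('i \<Rightarrow> 'a measure) \<Rightarrow> ('i \<Rightarrow> 'i \<Rightarrow> 'a \<Rightarrow> 'a) \<Rightarrow> real \<Rightarrow>
      ('i \<Rightarrow> ('a \<Rightarrow> real) set) set normed"
  where "LLp I leq X \<pi> p =
    quotient_space (co_cauchy_families I leq X \<pi> p) (asymptotic_rel I leq X \<pi> p)"

end

theory Submission
  imports Defs
begin

text \<open>
  The projections \<open>\<pi>\<^sub>i\<close> preserve measure, so pulling back along them embeds every \<open>L\<^sup>p(X\<^sub>i)\<close>
  isometrically into \<open>L\<^sup>p\<close> of the limit; write \<open>P\<^sub>i\<close> for this embedding. For \<open>i \<le> j\<close> it factors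
  through the pullback along \<open>\<pi>\<^sub>i\<^sub>j\<close>. Hence a family \<open>(f\<^sub>i)\<close> is co-Cauchy exactly if the net
  \<open>(P\<^sub>i f\<^sub>i)\<close> satisfies the Cauchy condition in \<open>L\<^sup>p\<close> of the limit (\<open>co_cauchy_iff\<close>). This space is
  complete (\<open>Lp_fast_cauchy_convergent\<close>), so the net has a unique limit \<open>U\<close>; the family then
  represents \<open>U\<close> (\<open>co_cauchy_imp_represents\<close>). Taking the limit is linear, and
  \<open>\<parallel>U\<parallel> = lim \<parallel>P\<^sub>i f\<^sub>i\<parallel> = lim \<parallel>f\<^sub>i\<parallel>\<close>. So the limits of norms in the definition of the norm exist, and the
  limit map becomes an isometry once families at asymptotic distance zero are identified
  (\<open>isometrically_isomorphic_quotient\<close>).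

  What remains is that every \<open>U\<close> is represented (\<open>ex_represents\<close>). The ranges of the \<open>P\<^sub>i\<close> increase with
  \<open>i\<close>, and their union is dense (\<open>approximable_Lp\<close>): the \<open>\<sigma>\<close>-algebra of the limit is generated by the
  cylinders \<open>\<pi>\<^sub>i\<^sup>-\<^sup>1(B)\<close>, which are stable under intersection since \<open>I\<close> is directed, so a Dynkin argument
  approximates all indicators, and monotone limits give all functions. Density says that the
  distance from \<open>U\<close> to the range of \<open>P\<^sub>i\<close> tends to zero along \<open>I\<close>. It therefore suffices to choose
  each \<open>f\<^sub>i\<close> as a best approximation of \<open>U\<close> up to the factor 2 (\<open>nearly_best_approximation\<close>).
\<close>

section \<open>Seminormed spaces and their quotients\<close>

text \<open>
  Before passing to quotients, both the functions of class \<open>L\<^sup>p\<close> and the co-Cauchy families have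
  nonzero elements of norm zero. Nonnegativity is a consequence of the axioms, by
  \<open>0 = nrm 0 = nrm (x - x) \<le> 2 nrm x\<close>.
\<close>

locale seminormed_space = Module.module real_ring V for V :: "'v normed" (structure) +
  assumes nrm_smult: "x \<in> carrier V \<Longrightarrow> nrm V (c \<odot>\<^bsub>V\<^esub> x) = \<bar>c\<bar> * nrm V x"
    and nrm_triangle: "x \<in> carrier V \<Longrightarrow> y \<in> carrier V \<Longrightarrow>
      nrm V (x \<oplus>\<^bsub>V\<^esub> y) \<le> nrm V x + nrm V y"

lemma real_ring_simps [simp]:
  "carrier real_ring = UNIV" "\<zero>\<^bsub>real_ring\<^esub> = 0" "\<one>\<^bsub>real_ring\<^esub> = 1"
  "a \<oplus>\<^bsub>real_ring\<^esub> b = a + b" "a \<otimes>\<^bsub>real_ring\<^esub> b = a * b"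
  by (simp_all add: real_ring_def)

lemma cring_real_ring: "cring real_ring"
  by (intro cringI abelian_groupI comm_monoidI)
     (auto simp: algebra_simps intro: exI[of _ "- _"])

lemma real_normed_space_iff:
  "real_normed_space V \<longleftrightarrow>
    seminormed_space V \<and> (\<forall>x\<in>carrier V. nrm V x = 0 \<longleftrightarrow> x = \<zero>\<^bsub>V\<^esub>)"
  by (auto simp: real_normed_space_def seminormed_space_def
      real_normed_space_axioms_def seminormed_space_axioms_def)

lemma real_normed_space_imp_seminormed: "real_normed_space V \<Longrightarrow> seminormed_space V"
  by (simp only: real_normed_space_iff)

text \<open>
  Additive inverses come from the scalar \<open>-1\<close>, so the group axioms reduce to those of a
  commutative monoid and \<open>0 x = 0\<close>.
\<close>

lemma seminormed_spaceI:
  fixes V :: "'v normed" (structure)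
  assumes "\<zero> \<in> carrier V"
    and "\<And>x y. x \<in> carrier V \<Longrightarrow> y \<in> carrier V \<Longrightarrow> x \<oplus> y \<in> carrier V"
    and "\<And>c x. x \<in> carrier V \<Longrightarrow> c \<odot> x \<in> carrier V"
    and "\<And>x y z. x \<in> carrier V \<Longrightarrow> y \<in> carrier V \<Longrightarrow> z \<in> carrier V \<Longrightarrow>
      (x \<oplus> y) \<oplus> z = x \<oplus> (y \<oplus> z)"
    and "\<And>x y. x \<in> carrier V \<Longrightarrow> y \<in> carrier V \<Longrightarrow> x \<oplus> y = y \<oplus> x"
    and "\<And>x. x \<in> carrier V \<Longrightarrow> \<zero> \<oplus> x = x"
    and "\<And>a b x. x \<in> carrier V \<Longrightarrow> (a + b) \<odot> x = a \<odot> x \<oplus> b \<odot> x"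
    and "\<And>a x y. x \<in> carrier V \<Longrightarrow> y \<in> carrier V \<Longrightarrow> a \<odot> (x \<oplus> y) = a \<odot> x \<oplus> a \<odot> y"
    and "\<And>a b x. x \<in> carrier V \<Longrightarrow> (a * b) \<odot> x = a \<odot> (b \<odot> x)"
    and "\<And>x. x \<in> carrier V \<Longrightarrow> 1 \<odot> x = x"
    and "\<And>x. x \<in> carrier V \<Longrightarrow> 0 \<odot> x = \<zero>"
    and "\<And>c x. x \<in> carrier V \<Longrightarrow> nrm V (c \<odot> x) = \<bar>c\<bar> * nrm V x"
    and "\<And>x y. x \<in> carrier V \<Longrightarrow> y \<in> carrier V \<Longrightarrow> nrm V (x \<oplus> y) \<le> nrm V x + nrm V y"
  shows "seminormed_space V"
proof -
  have inv: "\<exists>y\<in>carrier V. y \<oplus> x = \<zero>" if "x \<in> carrier V" for x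
  proof
    show "(-1) \<odot> x \<oplus> x = \<zero>"
      using assms(7)[OF that, of "-1" 1] assms(10,11)[OF that] by simp
  qed (use assms(3) that in blast)
  have "abelian_group V"
    by (rule abelian_groupI) (use assms(1,2,4,5,6) inv in blast)+
  then have "Module.module real_ring V"
    by (rule moduleI[OF cring_real_ring]) (use assms(3,7-10) in auto)
  then show ?thesis
    unfolding seminormed_space_def seminormed_space_axioms_def
    using assms(12,13) by blast
qed

context seminormed_space
begin

lemma smult_cl [simp]: "x \<in> carrier V \<Longrightarrow> c \<odot>\<^bsub>V\<^esub> x \<in> carrier V"
  by simp

lemma smult_zero_left [simp]: "x \<in> carrier V \<Longrightarrow> 0 \<odot>\<^bsub>V\<^esub> x = \<zero>\<^bsub>V\<^esub>"
  using smult_l_null by simp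

lemma smult_one_left [simp]: "x \<in> carrier V \<Longrightarrow> 1 \<odot>\<^bsub>V\<^esub> x = x"
  using smult_one by simp

lemma smult_add_left: "x \<in> carrier V \<Longrightarrow> (a + b) \<odot>\<^bsub>V\<^esub> x = a \<odot>\<^bsub>V\<^esub> x \<oplus>\<^bsub>V\<^esub> b \<odot>\<^bsub>V\<^esub> x"
  using smult_l_distr[of a b x] by simp

lemma smult_smult: "x \<in> carrier V \<Longrightarrow> (a * b) \<odot>\<^bsub>V\<^esub> x = a \<odot>\<^bsub>V\<^esub> (b \<odot>\<^bsub>V\<^esub> x)"
  using smult_assoc1[of a b x] by simp

lemma smult_add_right:
  "x \<in> carrier V \<Longrightarrow> y \<in> carrier V \<Longrightarrow> c \<odot>\<^bsub>V\<^esub> (x \<oplus>\<^bsub>V\<^esub> y) = c \<odot>\<^bsub>V\<^esub> x \<oplus>\<^bsub>V\<^esub> c \<odot>\<^bsub>V\<^esub> y"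
  using smult_r_distr[of c x y] by simp

lemma smult_neg_one: "x \<in> carrier V \<Longrightarrow> (-1) \<odot>\<^bsub>V\<^esub> x = \<ominus>\<^bsub>V\<^esub> x"
  using smult_add_left[of x "-1" 1] by (intro M.minus_equality[symmetric]) auto

lemma minus_eq_smult: "y \<in> carrier V \<Longrightarrow> x \<ominus>\<^bsub>V\<^esub> y = x \<oplus>\<^bsub>V\<^esub> (-1) \<odot>\<^bsub>V\<^esub> y"
  by (simp add: smult_neg_one a_minus_def)

lemma nrm_zero [simp]: "nrm V \<zero>\<^bsub>V\<^esub> = 0"
  using nrm_smult[of "\<zero>\<^bsub>V\<^esub>" 0] by simp

lemma nrm_uminus: "x \<in> carrier V \<Longrightarrow> nrm V (\<ominus>\<^bsub>V\<^esub> x) = nrm V x"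
  using nrm_smult[of x "-1"] by (simp add: smult_neg_one)

lemma nrm_nonneg: "x \<in> carrier V \<Longrightarrow> 0 \<le> nrm V x"
  using nrm_triangle[of x "\<ominus>\<^bsub>V\<^esub> x"] by (simp add: nrm_uminus M.r_neg)

lemma minus_zero_right: "x \<in> carrier V \<Longrightarrow> x \<ominus>\<^bsub>V\<^esub> \<zero>\<^bsub>V\<^esub> = x"
  using M.minus_equality[of "\<zero>\<^bsub>V\<^esub>" "\<zero>\<^bsub>V\<^esub>"] by (simp add: a_minus_def)

lemma minus_eq_zero_iff:
  assumes "x \<in> carrier V" "y \<in> carrier V"
  shows "x \<ominus>\<^bsub>V\<^esub> y = \<zero>\<^bsub>V\<^esub> \<longleftrightarrow> x = y"
  using assms M.minus_equality[of x "\<ominus>\<^bsub>V\<^esub> y"] by (auto simp: a_minus_def M.r_neg)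

lemma nrm_minus_self: "x \<in> carrier V \<Longrightarrow> nrm V (x \<ominus>\<^bsub>V\<^esub> x) = 0"
  by (simp add: a_minus_def M.r_neg)

lemma nrm_minus_commute:
  assumes "x \<in> carrier V" "y \<in> carrier V"
  shows "nrm V (x \<ominus>\<^bsub>V\<^esub> y) = nrm V (y \<ominus>\<^bsub>V\<^esub> x)"
proof -
  have "\<ominus>\<^bsub>V\<^esub> (x \<ominus>\<^bsub>V\<^esub> y) = y \<ominus>\<^bsub>V\<^esub> x"
    using assms by (simp add: a_minus_def M.minus_add M.a_comm)
  then show ?thesis
    using nrm_uminus[of "x \<ominus>\<^bsub>V\<^esub> y"] assms by simp
qed

lemma nrm_minus_triangle:
  assumes "x \<in> carrier V" "y \<in> carrier V" "z \<in> carrier V"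
  shows "nrm V (x \<ominus>\<^bsub>V\<^esub> z) \<le> nrm V (x \<ominus>\<^bsub>V\<^esub> y) + nrm V (y \<ominus>\<^bsub>V\<^esub> z)"
proof -
  have "x \<ominus>\<^bsub>V\<^esub> z = (x \<ominus>\<^bsub>V\<^esub> y) \<oplus>\<^bsub>V\<^esub> (y \<ominus>\<^bsub>V\<^esub> z)"
    using assms by (simp add: a_minus_def M.a_assoc M.r_neg1)
  then show ?thesis
    using nrm_triangle[of "x \<ominus>\<^bsub>V\<^esub> y" "y \<ominus>\<^bsub>V\<^esub> z"] assms by simp
qed

lemma nrm_diff_le:
  assumes "x \<in> carrier V" "y \<in> carrier V"
  shows "\<bar>nrm V x - nrm V y\<bar> \<le> nrm V (x \<ominus>\<^bsub>V\<^esub> y)"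
  using nrm_minus_triangle[of x y "\<zero>\<^bsub>V\<^esub>"] nrm_minus_triangle[of y x "\<zero>\<^bsub>V\<^esub>"]
    nrm_minus_commute[of x y] assms
  by (simp add: minus_zero_right)

lemma nrm_add_minus_add:
  assumes "x \<in> carrier V" "y \<in> carrier V" "u \<in> carrier V" "v \<in> carrier V"
  shows "nrm V ((x \<oplus>\<^bsub>V\<^esub> y) \<ominus>\<^bsub>V\<^esub> (u \<oplus>\<^bsub>V\<^esub> v)) \<le> nrm V (x \<ominus>\<^bsub>V\<^esub> u) + nrm V (y \<ominus>\<^bsub>V\<^esub> v)"
proof -
  have "(x \<oplus>\<^bsub>V\<^esub> y) \<ominus>\<^bsub>V\<^esub> (u \<oplus>\<^bsub>V\<^esub> v) = (x \<ominus>\<^bsub>V\<^esub> u) \<oplus>\<^bsub>V\<^esub> (y \<ominus>\<^bsub>V\<^esub> v)"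
    using assms by (simp add: a_minus_def M.minus_add M.a_ac)
  then show ?thesis
    using nrm_triangle[of "x \<ominus>\<^bsub>V\<^esub> u" "y \<ominus>\<^bsub>V\<^esub> v"] assms by simp
qed

lemma nrm_smult_minus_smult:
  assumes "x \<in> carrier V" "y \<in> carrier V"
  shows "nrm V ((c \<odot>\<^bsub>V\<^esub> x) \<ominus>\<^bsub>V\<^esub> (c \<odot>\<^bsub>V\<^esub> y)) = \<bar>c\<bar> * nrm V (x \<ominus>\<^bsub>V\<^esub> y)"
proof -
  have "(c \<odot>\<^bsub>V\<^esub> x) \<ominus>\<^bsub>V\<^esub> (c \<odot>\<^bsub>V\<^esub> y) = c \<odot>\<^bsub>V\<^esub> (x \<ominus>\<^bsub>V\<^esub> y)"
    using assms by (simp add: minus_eq_smult smult_add_right flip: smult_smult)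
  then show ?thesis
    using assms by (simp add: nrm_smult)
qed

end

text \<open>
  Both relations by which the quotients are formed, equality almost everywhere and asymptotic
  equality of families, are instances of this one, so the quotient is analysed only once.
\<close>

definition seminorm_rel :: "'v normed \<Rightarrow> ('v \<times> 'v) set"
  where "seminorm_rel V =
    {(x, y). x \<in> carrier V \<and> y \<in> carrier V \<and> nrm V (x \<ominus>\<^bsub>V\<^esub> y) = 0}"

context seminormed_space
begin

lemma equiv_seminorm_rel: "equiv (carrier V) (seminorm_rel V)"
proof (rule equivI)
  show "refl_on (carrier V) (seminorm_rel V)"
    by (auto simp: refl_on_def seminorm_rel_def nrm_minus_self)
  show "sym (seminorm_rel V)"
    by (auto simp: sym_def seminorm_rel_def nrm_minus_commute)
  show "trans (seminorm_rel V)"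
  proof (rule transI)
    fix x y z assume "(x, y) \<in> seminorm_rel V" "(y, z) \<in> seminorm_rel V"
    then show "(x, z) \<in> seminorm_rel V"
      using nrm_minus_triangle[of x y z] nrm_nonneg[of "x \<ominus>\<^bsub>V\<^esub> z"]
      by (auto simp: seminorm_rel_def)
  qed
qed (auto simp: seminorm_rel_def)

abbreviation "Q \<equiv> quotient_space V (seminorm_rel V)"
abbreviation "cls x \<equiv> seminorm_rel V `` {x}"

lemma cls_eq_iff:
  "x \<in> carrier V \<Longrightarrow> y \<in> carrier V \<Longrightarrow> cls x = cls y \<longleftrightarrow> nrm V (x \<ominus>\<^bsub>V\<^esub> y) = 0"
  by (simp add: eq_equiv_class_iff[OF equiv_seminorm_rel]) (simp add: seminorm_rel_def)

lemma self_in_cls: "x \<in> carrier V \<Longrightarrow> x \<in> cls x"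
  using equiv_class_self[OF equiv_seminorm_rel] .

lemma carrier_quotient: "carrier Q = cls ` carrier V"
  by (auto simp: quotient_space_def quotient_def)

lemma zero_quotient: "\<zero>\<^bsub>Q\<^esub> = cls \<zero>\<^bsub>V\<^esub>"
  by (simp add: quotient_space_def)

lemma add_quotient:
  assumes "x \<in> carrier V" "y \<in> carrier V"
  shows "cls x \<oplus>\<^bsub>Q\<^esub> cls y = cls (x \<oplus>\<^bsub>V\<^esub> y)"
proof -
  have "congruent2 (seminorm_rel V) (seminorm_rel V) (\<lambda>a b. cls (a \<oplus>\<^bsub>V\<^esub> b))"
  proof (rule congruent2I')
    fix x x' y y' assume "(x, x') \<in> seminorm_rel V" "(y, y') \<in> seminorm_rel V"
    then have *: "x \<in> carrier V" "x' \<in> carrier V" "y \<in> carrier V" "y' \<in> carrier V"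
      "nrm V (x \<ominus>\<^bsub>V\<^esub> x') = 0" "nrm V (y \<ominus>\<^bsub>V\<^esub> y') = 0"
      by (auto simp: seminorm_rel_def)
    then show "cls (x \<oplus>\<^bsub>V\<^esub> y) = cls (x' \<oplus>\<^bsub>V\<^esub> y')"
      using nrm_add_minus_add[of x y x' y'] nrm_nonneg[of "(x \<oplus>\<^bsub>V\<^esub> y) \<ominus>\<^bsub>V\<^esub> (x' \<oplus>\<^bsub>V\<^esub> y')"]
      by (simp add: cls_eq_iff)
  qed
  from UN_equiv_class2[OF equiv_seminorm_rel equiv_seminorm_rel this assms] show ?thesis
    by (simp add: quotient_space_def)
qed

lemma smult_quotient:
  assumes "x \<in> carrier V"
  shows "c \<odot>\<^bsub>Q\<^esub> cls x = cls (c \<odot>\<^bsub>V\<^esub> x)"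
proof -
  have "congruent (seminorm_rel V) (\<lambda>a. cls (c \<odot>\<^bsub>V\<^esub> a))"
  proof (rule congruentI)
    fix x y assume "(x, y) \<in> seminorm_rel V"
    then show "cls (c \<odot>\<^bsub>V\<^esub> x) = cls (c \<odot>\<^bsub>V\<^esub> y)"
      using nrm_smult_minus_smult[of x y c]
      by (subst cls_eq_iff) (auto simp: seminorm_rel_def)
  qed
  from UN_equiv_class[OF equiv_seminorm_rel this assms] show ?thesis
    by (simp add: quotient_space_def)
qed

lemma nrm_quotient:
  assumes "x \<in> carrier V"
  shows "nrm Q (cls x) = nrm V x"
proof -
  have "nrm V y = nrm V x" if "y \<in> cls x" for y
    using that nrm_diff_le[of x y] by (auto simp: seminorm_rel_def)
  then have "nrm V ` cls x = {nrm V x}"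
    using self_in_cls[OF assms] by blast
  then show ?thesis
    by (simp add: quotient_space_def)
qed

lemma real_normed_space_quotient: "real_normed_space Q"
proof -
  have rep: "\<exists>x\<in>carrier V. A = cls x" if "A \<in> carrier Q" for A
    using that by (auto simp: carrier_quotient)
  have "seminormed_space Q"
  proof (rule seminormed_spaceI)
    show "\<zero>\<^bsub>Q\<^esub> \<in> carrier Q"
      by (simp add: carrier_quotient zero_quotient)
  next
    fix A B C assume "A \<in> carrier Q" "B \<in> carrier Q" "C \<in> carrier Q"
    then obtain x y z where "x \<in> carrier V" "y \<in> carrier V" "z \<in> carrier V"
      and "A = cls x" "B = cls y" "C = cls z"
      using rep by meson
    then show "(A \<oplus>\<^bsub>Q\<^esub> B) \<oplus>\<^bsub>Q\<^esub> C = A \<oplus>\<^bsub>Q\<^esub> (B \<oplus>\<^bsub>Q\<^esub> C)"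
      by (simp add: add_quotient M.a_assoc)
  next
    fix A B assume "A \<in> carrier Q" "B \<in> carrier Q"
    then obtain x y where xy: "x \<in> carrier V" "y \<in> carrier V" "A = cls x" "B = cls y"
      using rep by meson
    show "A \<oplus>\<^bsub>Q\<^esub> B \<in> carrier Q"
      using xy by (simp add: carrier_quotient add_quotient)
    show "A \<oplus>\<^bsub>Q\<^esub> B = B \<oplus>\<^bsub>Q\<^esub> A"
      using xy M.a_comm[of x y] by (simp add: add_quotient)
    show "c \<odot>\<^bsub>Q\<^esub> (A \<oplus>\<^bsub>Q\<^esub> B) = c \<odot>\<^bsub>Q\<^esub> A \<oplus>\<^bsub>Q\<^esub> c \<odot>\<^bsub>Q\<^esub> B" for c
      using xy by (simp add: add_quotient smult_quotient smult_add_right)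
    show "nrm Q (A \<oplus>\<^bsub>Q\<^esub> B) \<le> nrm Q A + nrm Q B"
      using xy by (simp add: add_quotient nrm_quotient nrm_triangle)
  next
    fix A assume "A \<in> carrier Q"
    then obtain x where x: "x \<in> carrier V" "A = cls x"
      using rep by meson
    show "\<zero>\<^bsub>Q\<^esub> \<oplus>\<^bsub>Q\<^esub> A = A" "1 \<odot>\<^bsub>Q\<^esub> A = A" "0 \<odot>\<^bsub>Q\<^esub> A = \<zero>\<^bsub>Q\<^esub>"
      using x by (simp_all add: zero_quotient add_quotient smult_quotient)
    show "c \<odot>\<^bsub>Q\<^esub> A \<in> carrier Q" "nrm Q (c \<odot>\<^bsub>Q\<^esub> A) = \<bar>c\<bar> * nrm Q A" for c
      using x by (simp_all add: carrier_quotient smult_quotient nrm_quotient nrm_smult)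
    show "(a + b) \<odot>\<^bsub>Q\<^esub> A = a \<odot>\<^bsub>Q\<^esub> A \<oplus>\<^bsub>Q\<^esub> b \<odot>\<^bsub>Q\<^esub> A"
      "(a * b) \<odot>\<^bsub>Q\<^esub> A = a \<odot>\<^bsub>Q\<^esub> (b \<odot>\<^bsub>Q\<^esub> A)" for a b
      using x by (simp_all add: smult_quotient add_quotient smult_add_left smult_smult)
  qed
  moreover have "nrm Q A = 0 \<longleftrightarrow> A = \<zero>\<^bsub>Q\<^esub>" if A: "A \<in> carrier Q" for A
  proof -
    obtain x where "x \<in> carrier V" "A = cls x"
      using rep[OF A] by blast
    then show ?thesis
      by (simp add: nrm_quotient zero_quotient cls_eq_iff minus_zero_right)
  qed
  ultimately show ?thesis
    by (simp add: real_normed_space_iff)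
qed

lemma minus_quotient:
  assumes "x \<in> carrier V" "y \<in> carrier V"
  shows "cls x \<ominus>\<^bsub>Q\<^esub> cls y = cls (x \<ominus>\<^bsub>V\<^esub> y)"
proof -
  have Q: "seminormed_space Q"
    by (rule real_normed_space_imp_seminormed[OF real_normed_space_quotient])
  have "cls x \<ominus>\<^bsub>Q\<^esub> cls y = cls x \<oplus>\<^bsub>Q\<^esub> (-1) \<odot>\<^bsub>Q\<^esub> cls y"
    using assms by (intro seminormed_space.minus_eq_smult[OF Q]) (simp add: carrier_quotient)
  also have "\<dots> = cls (x \<ominus>\<^bsub>V\<^esub> y)"
    using assms by (simp only: smult_quotient smult_cl add_quotient minus_eq_smult)
  finally show ?thesis .
qed

text \<open>
  The first isomorphism theorem. A linear map onto a normed space that preserves the seminorm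
  has the classes of seminorm-distance zero as its fibres, so taking fibres is the inverse
  isometry.
\<close>

lemma isometrically_isomorphic_quotient:
  assumes W: "real_normed_space W"
    and onto: "S ` carrier V = carrier W"
    and add: "\<And>x y. x \<in> carrier V \<Longrightarrow> y \<in> carrier V \<Longrightarrow> S (x \<oplus>\<^bsub>V\<^esub> y) = S x \<oplus>\<^bsub>W\<^esub> S y"
    and smult: "\<And>c x. x \<in> carrier V \<Longrightarrow> S (c \<odot>\<^bsub>V\<^esub> x) = c \<odot>\<^bsub>W\<^esub> S x"
    and nrm: "\<And>x. x \<in> carrier V \<Longrightarrow> nrm W (S x) = nrm V x"
  shows "isometrically_isomorphic W Q"
proof -
  note W' = real_normed_space_imp_seminormed[OF W]
  have S: "S x \<in> carrier W" if "x \<in> carrier V" for x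
    using onto that by blast
  have S_eq: "S x = S y \<longleftrightarrow> nrm V (x \<ominus>\<^bsub>V\<^esub> y) = 0" if xy: "x \<in> carrier V" "y \<in> carrier V" for x y
  proof -
    have "S (x \<ominus>\<^bsub>V\<^esub> y) = S x \<oplus>\<^bsub>W\<^esub> (-1) \<odot>\<^bsub>W\<^esub> S y"
      by (simp only: minus_eq_smult add smult smult_cl xy)
    also have "\<dots> = S x \<ominus>\<^bsub>W\<^esub> S y"
      by (rule seminormed_space.minus_eq_smult[OF W' S[OF xy(2)], symmetric])
    finally have *: "S (x \<ominus>\<^bsub>V\<^esub> y) = S x \<ominus>\<^bsub>W\<^esub> S y" .
    have "nrm V (x \<ominus>\<^bsub>V\<^esub> y) = nrm W (S x \<ominus>\<^bsub>W\<^esub> S y)"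
      unfolding *[symmetric] by (intro nrm[symmetric] M.minus_closed xy)
    also have "\<dots> = 0 \<longleftrightarrow> S x \<ominus>\<^bsub>W\<^esub> S y = \<zero>\<^bsub>W\<^esub>"
      unfolding *[symmetric] by (intro real_normed_space.nrm_eq_zero_iff[OF W] S M.minus_closed xy)
    also have "\<dots> \<longleftrightarrow> S x = S y"
      by (intro seminormed_space.minus_eq_zero_iff[OF W'] S xy)
    finally show ?thesis ..
  qed
  define T where "T w = {x \<in> carrier V. S x = w}" for w
  have T: "T (S x) = cls x" if "x \<in> carrier V" for x
    using that by (auto simp: T_def seminorm_rel_def S_eq[OF that, symmetric])
  have W_eq: "carrier W = S ` carrier V"
    using onto by simp
  have "isometric_isomorphism W Q T"
    unfolding isometric_isomorphism_def
  proof (intro conjI ballI allI)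
    show "bij_betw T (carrier W) (carrier Q)"
    proof (rule bij_betw_imageI)
      show "inj_on T (carrier W)"
      proof (rule inj_onI)
        fix v w assume "v \<in> carrier W" "w \<in> carrier W" and eq: "T v = T w"
        then obtain x y where xy: "x \<in> carrier V" "y \<in> carrier V" "v = S x" "w = S y"
          unfolding W_eq by blast
        then have "cls x = cls y"
          using eq by (simp only: T)
        then show "v = w"
          using xy by (simp only: cls_eq_iff S_eq)
      qed
      show "T ` carrier W = carrier Q"
        unfolding W_eq carrier_quotient image_image by (intro image_cong refl T)
    qed
  next
    fix v w assume "v \<in> carrier W" "w \<in> carrier W"
    then obtain x y where xy: "x \<in> carrier V" "y \<in> carrier V" "v = S x" "w = S y"
      unfolding W_eq by blast
    have "T (v \<oplus>\<^bsub>W\<^esub> w) = T (S (x \<oplus>\<^bsub>V\<^esub> y))"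
      by (simp only: xy add)
    then show "T (v \<oplus>\<^bsub>W\<^esub> w) = T v \<oplus>\<^bsub>Q\<^esub> T w"
      using xy by (simp only: T M.a_closed add_quotient)
  next
    fix c w assume "w \<in> carrier W"
    then obtain x where x: "x \<in> carrier V" "w = S x"
      unfolding W_eq by blast
    have "T (c \<odot>\<^bsub>W\<^esub> w) = T (S (c \<odot>\<^bsub>V\<^esub> x))"
      by (simp only: x smult)
    then show "T (c \<odot>\<^bsub>W\<^esub> w) = c \<odot>\<^bsub>Q\<^esub> T w"
      using x by (simp only: T smult_cl smult_quotient)
  next
    fix w assume "w \<in> carrier W"
    then obtain x where x: "x \<in> carrier V" "w = S x"
      unfolding W_eq by blast
    then show "nrm Q (T w) = nrm W w"
      by (simp only: T nrm_quotient nrm)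
  qed
  then show ?thesis
    using W real_normed_space_quotient by (auto simp: isometrically_isomorphic_def)
qed

end

section \<open>The seminorm on the functions of class $L^p$\<close>

lemma in_Lp_functions_iff:
  "u \<in> carrier (Lp_functions M p) \<longleftrightarrow>
    u \<in> borel_measurable M \<and> integrable M (\<lambda>x. \<bar>u x\<bar> powr p)"
  by (simp add: Lp_functions_def)

lemma Lp_functions_simps [simp]:
  "\<zero>\<^bsub>Lp_functions M p\<^esub> = (\<lambda>x. 0)"
  "u \<oplus>\<^bsub>Lp_functions M p\<^esub> v = (\<lambda>x. u x + v x)"
  "c \<odot>\<^bsub>Lp_functions M p\<^esub> u = (\<lambda>x. c * u x)"
  by (simp_all add: Lp_functions_def)

lemma nrm_Lp_functions: "nrm (Lp_functions M p) u = (\<integral>x. \<bar>u x\<bar> powr p \<partial>M) powr (1 / p)"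
  by (simp add: Lp_functions_def)

text \<open>
  This is convexity of the \<open>p\<close>-th power on the closed half-line. At an end point it reduces to
  \<open>c\<^sup>p \<le> c\<close> for a weight \<open>c \<le> 1\<close>.
\<close>

lemma powr_weighted_mean_le:
  fixes a b x y p :: real
  assumes p: "1 \<le> p" and ab: "0 \<le> a" "0 \<le> b" "a + b = 1" and xy: "0 \<le> x" "0 \<le> y"
  shows "(a * x + b * y) powr p \<le> a * x powr p + b * y powr p"
proof -
  have scale: "(c * z) powr p \<le> c * z powr p" if "0 \<le> c" "c \<le> 1" "0 \<le> z" for c z :: real
  proof -
    have "c powr p \<le> c"
      using powr_mono'[of 1 p c] p that by simp
    then show ?thesis
      using that by (simp add: powr_mult mult_right_mono)
  qed
  consider "x = 0" | "y = 0" | "0 < x" "0 < y"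
    using xy by fastforce
  then show ?thesis
  proof cases
    case 3
    have a: "a = 1 - b"
      using ab by simp
    show ?thesis
      unfolding a using 3 convex_onD[OF powr_convex[OF p], of b x y] ab by simp
  qed (use scale[of a x] scale[of b y] ab xy in auto)
qed

lemma Lp_functions_nrm_nonneg: "0 \<le> nrm (Lp_functions M p) u"
  by (simp add: nrm_Lp_functions)

context
  fixes M :: "'a measure" and p :: real
  assumes p: "1 \<le> p"
begin

lemma nrm_powr:
  "nrm (Lp_functions M p) u powr p = (\<integral>x. \<bar>u x\<bar> powr p \<partial>M)"
  using p by (simp add: nrm_Lp_functions powr_powr)

lemma nrm_le_iff:
  assumes "0 \<le> c"
  shows "nrm (Lp_functions M p) u \<le> c \<longleftrightarrow> (\<integral>x. \<bar>u x\<bar> powr p \<partial>M) \<le> c powr p"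
proof
  assume "nrm (Lp_functions M p) u \<le> c"
  from powr_mono2[OF _ Lp_functions_nrm_nonneg this, of p] p
  show "(\<integral>x. \<bar>u x\<bar> powr p \<partial>M) \<le> c powr p"
    by (simp add: nrm_powr)
next
  assume "(\<integral>x. \<bar>u x\<bar> powr p \<partial>M) \<le> c powr p"
  from powr_mono2[OF _ _ this, of "1 / p"] p assms
  show "nrm (Lp_functions M p) u \<le> c"
    by (simp add: nrm_Lp_functions powr_powr)
qed

lemma Lp_functions_bounded:
  assumes "u \<in> borel_measurable M" "g \<in> carrier (Lp_functions M p)"
    and "\<And>x. x \<in> space M \<Longrightarrow> \<bar>u x\<bar> \<le> \<bar>g x\<bar>"
  shows "u \<in> carrier (Lp_functions M p)"
proof -
  have "integrable M (\<lambda>x. \<bar>u x\<bar> powr p)"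
  proof (rule Bochner_Integration.integrable_bound)
    show "integrable M (\<lambda>x. \<bar>g x\<bar> powr p)"
      using assms(2) by (simp add: in_Lp_functions_iff)
    show "AE x in M. norm (\<bar>u x\<bar> powr p) \<le> norm (\<bar>g x\<bar> powr p)"
      using assms(3) p by (intro AE_I2) (auto intro: powr_mono2)
  qed (use assms(1) in measurable)
  then show ?thesis
    using assms(1) by (simp add: in_Lp_functions_iff)
qed

lemma Lp_functions_smult_closed:
  assumes "u \<in> carrier (Lp_functions M p)"
  shows "(\<lambda>x. c * u x) \<in> carrier (Lp_functions M p)"
  using assms by (auto simp: in_Lp_functions_iff abs_mult powr_mult)

text \<open>
  The crude bound \<open>\<bar>a + b\<bar>\<^sup>p \<le> (2 max \<bar>a\<bar> \<bar>b\<bar>)\<^sup>p\<close> suffices for integrability of the sum.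
\<close>

lemma Lp_functions_add_closed:
  assumes "u \<in> carrier (Lp_functions M p)" "v \<in> carrier (Lp_functions M p)"
  shows "(\<lambda>x. u x + v x) \<in> carrier (Lp_functions M p)"
proof -
  have [measurable]: "u \<in> borel_measurable M" "v \<in> borel_measurable M"
    using assms by (auto simp: in_Lp_functions_iff)
  have "integrable M (\<lambda>x. \<bar>u x + v x\<bar> powr p)"
  proof (rule Bochner_Integration.integrable_bound)
    show "integrable M (\<lambda>x. 2 powr p * (\<bar>u x\<bar> powr p + \<bar>v x\<bar> powr p))"
      using assms by (auto simp: in_Lp_functions_iff)
    have "\<bar>a + b\<bar> powr p \<le> 2 powr p * (\<bar>a\<bar> powr p + \<bar>b\<bar> powr p)" for a b :: real
    proof -
      have "\<bar>a + b\<bar> powr p \<le> (2 * max \<bar>a\<bar> \<bar>b\<bar>) powr p"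
        using p by (intro powr_mono2) auto
      also have "\<dots> = 2 powr p * max \<bar>a\<bar> \<bar>b\<bar> powr p"
        by (simp add: powr_mult)
      also have "\<dots> \<le> 2 powr p * (\<bar>a\<bar> powr p + \<bar>b\<bar> powr p)"
        by (intro mult_left_mono) (auto simp: max_def)
      finally show ?thesis .
    qed
    then show "AE x in M. norm (\<bar>u x + v x\<bar> powr p)
        \<le> norm (2 powr p * (\<bar>u x\<bar> powr p + \<bar>v x\<bar> powr p))"
      by (intro AE_I2) (simp add: abs_mult)
  qed simp
  then show ?thesis
    by (simp add: in_Lp_functions_iff)
qed

lemma Lp_functions_nrm_smult:
  "nrm (Lp_functions M p) (\<lambda>x. c * u x) = \<bar>c\<bar> * nrm (Lp_functions M p) u"
  using p by (simp add: nrm_Lp_functions abs_mult powr_mult powr_powr)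

text \<open>
  Minkowski's inequality. For \<open>A > \<parallel>u\<parallel>\<close> and \<open>B > \<parallel>v\<parallel>\<close>, the number \<open>\<bar>u + v\<bar> / (A + B)\<close> is
  dominated by the convex combination of \<open>\<bar>u\<bar> / A\<close> and \<open>\<bar>v\<bar> / B\<close> with weights \<open>A / (A + B)\<close> and
  \<open>B / (A + B)\<close>. Convexity of the \<open>p\<close>-th power and integration give \<open>\<parallel>u + v\<parallel> \<le> A + B\<close>. The strict
  inequalities avoid a separate treatment of functions of norm zero.
\<close>

lemma Lp_functions_nrm_triangle:
  assumes u: "u \<in> carrier (Lp_functions M p)" and v: "v \<in> carrier (Lp_functions M p)"
  shows "nrm (Lp_functions M p) (\<lambda>x. u x + v x) \<le>
    nrm (Lp_functions M p) u + nrm (Lp_functions M p) v"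
proof (rule field_le_epsilon)
  fix e :: real assume e: "0 < e"
  define A where "A = nrm (Lp_functions M p) u + e / 2"
  define B where "B = nrm (Lp_functions M p) v + e / 2"
  have pos: "A > 0" "B > 0"
    using e Lp_functions_nrm_nonneg[of M p u] Lp_functions_nrm_nonneg[of M p v]
    by (auto simp: A_def B_def)
  have uA: "(\<integral>x. \<bar>u x\<bar> powr p \<partial>M) \<le> A powr p"
    using pos e by (subst nrm_le_iff[symmetric]) (auto simp: A_def)
  have vB: "(\<integral>x. \<bar>v x\<bar> powr p \<partial>M) \<le> B powr p"
    using pos e by (subst nrm_le_iff[symmetric]) (auto simp: B_def)
  define a where "a = A / (A + B)"
  define b where "b = B / (A + B)"
  have ab: "0 \<le> a" "0 \<le> b" "a + b = 1"
    using pos by (auto simp: a_def b_def simp flip: add_divide_distrib)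
  define g where "g x = (A + B) powr p * (a * (\<bar>u x\<bar> powr p / A powr p) + b * (\<bar>v x\<bar> powr p / B powr p))" for x
  have g: "integrable M g"
    using u v unfolding g_def by (auto simp: in_Lp_functions_iff)
  have le: "\<bar>u x + v x\<bar> powr p \<le> g x" for x
  proof -
    have "\<bar>u x + v x\<bar> \<le> (A + B) * (a * (\<bar>u x\<bar> / A) + b * (\<bar>v x\<bar> / B))"
      using pos by (auto simp: a_def b_def distrib_left)
    then have "\<bar>u x + v x\<bar> powr p \<le> ((A + B) * (a * (\<bar>u x\<bar> / A) + b * (\<bar>v x\<bar> / B))) powr p"
      using p by (intro powr_mono2) auto
    also have "\<dots> = (A + B) powr p * (a * (\<bar>u x\<bar> / A) + b * (\<bar>v x\<bar> / B)) powr p"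
      using pos ab by (intro powr_mult)
    also have "(a * (\<bar>u x\<bar> / A) + b * (\<bar>v x\<bar> / B)) powr p \<le>
        a * (\<bar>u x\<bar> / A) powr p + b * (\<bar>v x\<bar> / B) powr p"
      using p ab pos by (intro powr_weighted_mean_le) auto
    also have "\<dots> = a * (\<bar>u x\<bar> powr p / A powr p) + b * (\<bar>v x\<bar> powr p / B powr p)"
      using pos by (simp add: powr_divide)
    finally show ?thesis
      by (simp add: g_def mult_left_mono)
  qed
  have "(\<integral>x. \<bar>u x + v x\<bar> powr p \<partial>M) \<le> (\<integral>x. g x \<partial>M)"
    using Lp_functions_add_closed[OF u v] g le
    by (intro integral_mono) (auto simp: in_Lp_functions_iff)
  also have "\<dots> = (A + B) powr p *
      (a * ((\<integral>x. \<bar>u x\<bar> powr p \<partial>M) / A powr p) + b * ((\<integral>x. \<bar>v x\<bar> powr p \<partial>M) / B powr p))"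
    using u v unfolding g_def by (auto simp: in_Lp_functions_iff)
  also have "\<dots> \<le> (A + B) powr p * (a * 1 + b * 1)"
    using ab uA vB pos by (intro mult_left_mono add_mono) auto
  finally have "nrm (Lp_functions M p) (\<lambda>x. u x + v x) \<le> A + B"
    using pos ab by (subst nrm_le_iff) auto
  then show "nrm (Lp_functions M p) (\<lambda>x. u x + v x) \<le>
      nrm (Lp_functions M p) u + nrm (Lp_functions M p) v + e"
    by (simp add: A_def B_def)
qed

lemma seminormed_space_Lp_functions: "seminormed_space (Lp_functions M p)"
proof (rule seminormed_spaceI)
  show "\<zero>\<^bsub>Lp_functions M p\<^esub> \<in> carrier (Lp_functions M p)"
    by (simp add: in_Lp_functions_iff)
qed (use Lp_functions_add_closed Lp_functions_smult_closed Lp_functions_nrm_smult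
    Lp_functions_nrm_triangle in \<open>auto simp: algebra_simps\<close>)

lemma Lp_functions_minus:
  assumes "v \<in> carrier (Lp_functions M p)"
  shows "u \<ominus>\<^bsub>Lp_functions M p\<^esub> v = (\<lambda>x. u x - v x)"
  using seminormed_space.minus_eq_smult[OF seminormed_space_Lp_functions assms, of u] by simp

lemma Lp_functions_diff_closed:
  assumes "u \<in> carrier (Lp_functions M p)" "v \<in> carrier (Lp_functions M p)"
  shows "(\<lambda>x. u x - v x) \<in> carrier (Lp_functions M p)"
  using Lp_functions_add_closed[OF assms(1) Lp_functions_smult_closed[OF assms(2), of "-1"]]
  by simp

lemma Lp_functions_nrm_eq_zero_iff:
  assumes "u \<in> carrier (Lp_functions M p)"
  shows "nrm (Lp_functions M p) u = 0 \<longleftrightarrow> (AE x in M. u x = 0)"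
  using assms p
  by (simp add: nrm_Lp_functions in_Lp_functions_iff integral_nonneg_eq_0_iff_AE)

lemma ae_eq_rel_eq_seminorm_rel: "ae_eq_rel M p = seminorm_rel (Lp_functions M p)"
  by (auto simp: ae_eq_rel_def seminorm_rel_def Lp_functions_minus
      Lp_functions_nrm_eq_zero_iff Lp_functions_diff_closed)

end

lemma Lp_functions_dominated_convergence:
  assumes p: "1 \<le> p" and g: "g \<in> carrier (Lp_functions M p)"
    and U: "\<And>n. U n \<in> borel_measurable M"
    and le: "\<And>n x. x \<in> space M \<Longrightarrow> \<bar>U n x\<bar> \<le> \<bar>g x\<bar>"
    and lim: "\<And>x. x \<in> space M \<Longrightarrow> (\<lambda>n. U n x) \<longlonglongrightarrow> 0"
  shows "(\<lambda>n. nrm (Lp_functions M p) (U n)) \<longlonglongrightarrow> 0"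
proof -
  have "(\<lambda>n. \<integral>x. \<bar>U n x\<bar> powr p \<partial>M) \<longlonglongrightarrow> (\<integral>x. 0 \<partial>M)"
  proof (rule integral_dominated_convergence)
    show "integrable M (\<lambda>x. \<bar>g x\<bar> powr p)"
      using g by (simp add: in_Lp_functions_iff)
    show "AE x in M. (\<lambda>n. \<bar>U n x\<bar> powr p) \<longlonglongrightarrow> 0"
    proof (rule AE_I2)
      fix x assume "x \<in> space M"
      from tendsto_powr'[OF tendsto_rabs[OF lim[OF this]] tendsto_const, of p]
      show "(\<lambda>n. \<bar>U n x\<bar> powr p) \<longlonglongrightarrow> 0"
        using p by simp
    qed
    show "AE x in M. norm (\<bar>U n x\<bar> powr p) \<le> \<bar>g x\<bar> powr p" for n
      using p le by (intro AE_I2) (auto intro: powr_mono2)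
  qed (use U in measurable)
  from tendsto_powr'[OF this tendsto_const, of "1 / p"] show ?thesis
    using p by (simp add: nrm_Lp_functions)
qed

lemma
  assumes \<phi>: "\<phi> \<in> M \<rightarrow>\<^sub>M N" "distr M N \<phi> = N"
    and u: "u \<in> carrier (Lp_functions N p)"
  shows Lp_functions_compose: "u \<circ> \<phi> \<in> carrier (Lp_functions M p)"
    and nrm_Lp_functions_compose:
      "nrm (Lp_functions M p) (u \<circ> \<phi>) = nrm (Lp_functions N p) u"
proof -
  have [measurable]: "u \<in> borel_measurable N"
    using u by (simp add: in_Lp_functions_iff)
  have "integrable (distr M N \<phi>) (\<lambda>x. \<bar>u x\<bar> powr p)"
    using u \<phi>(2) by (simp add: in_Lp_functions_iff)
  then show "u \<circ> \<phi> \<in> carrier (Lp_functions M p)"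
    using \<phi>(1) by (simp add: in_Lp_functions_iff integrable_distr_eq)
  have "(\<integral>x. \<bar>u x\<bar> powr p \<partial>distr M N \<phi>) = (\<integral>x. \<bar>u (\<phi> x)\<bar> powr p \<partial>M)"
    by (rule integral_distr[OF \<phi>(1)]) simp
  then show "nrm (Lp_functions M p) (u \<circ> \<phi>) = nrm (Lp_functions N p) u"
    by (simp add: nrm_Lp_functions \<phi>(2))
qed

section \<open>Completeness of $L^p$\<close>

text \<open>
  The core of the Riesz--Fischer theorem. It is enough to treat increments of norm at most \<open>4\<^sup>-\<^sup>n\<close>,
  since a Cauchy sequence or net can be thinned out to this rate. The functions
  \<open>(2\<^sup>n \<bar>u\<^sub>n - u\<^sub>n\<^sub>+\<^sub>1\<bar>)\<^sup>p\<close> have a summable sequence of integrals, hence tend to zero almost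
  everywhere, so \<open>\<bar>u\<^sub>n - u\<^sub>n\<^sub>+\<^sub>1\<bar> \<le> 2\<^sup>-\<^sup>n\<close> from some point on, which is
  summable.
\<close>

lemma Lp_functions_fast_cauchy_AE_convergent:
  assumes p: "1 \<le> p" and u: "\<And>n. u n \<in> carrier (Lp_functions M p)"
    and fast: "\<And>n. nrm (Lp_functions M p) (\<lambda>x. u n x - u (Suc n) x) \<le> (1 / 4) ^ n"
  shows "AE x in M. convergent (\<lambda>n. u n x)"
proof -
  have [measurable]: "u n \<in> borel_measurable M" for n
    using u by (simp add: in_Lp_functions_iff)
  define h where "h n x = (2 ^ n * \<bar>u n x - u (Suc n) x\<bar>) powr p" for n x
  have [measurable]: "h n \<in> borel_measurable M" for n
    unfolding h_def by measurable
  have h_nonneg: "0 \<le> h n x" for n x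
    by (simp add: h_def)
  have h_le: "(\<integral>\<^sup>+x. ennreal (h n x) \<partial>M) \<le> ennreal ((1 / 2) ^ n)" for n
  proof -
    have diff: "(\<lambda>x. 2 ^ n * (u n x - u (Suc n) x)) \<in> carrier (Lp_functions M p)"
      by (intro Lp_functions_smult_closed Lp_functions_diff_closed p u)
    have "nrm (Lp_functions M p) (\<lambda>x. 2 ^ n * (u n x - u (Suc n) x)) \<le> 2 ^ n * (1 / 4) ^ n"
      using fast[of n] by (simp add: Lp_functions_nrm_smult[OF p])
    also have "\<dots> = (1 / 2) ^ n"
      by (simp flip: power_mult_distrib)
    finally have "(\<integral>x. h n x \<partial>M) \<le> ((1 / 2) ^ n) powr p"
      by (simp add: nrm_le_iff[OF p] h_def abs_mult)
    also have "\<dots> \<le> ((1 / 2) ^ n) powr 1"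
      using p by (intro powr_mono') (auto simp: power_le_one)
    finally have "(\<integral>x. h n x \<partial>M) \<le> (1 / 2) ^ n"
      by simp
    moreover have "integrable M (h n)"
      using diff by (simp add: in_Lp_functions_iff h_def[abs_def] abs_mult)
    ultimately show ?thesis
      by (subst nn_integral_eq_integral) (auto simp: h_nonneg ennreal_leI)
  qed
  have "(\<integral>\<^sup>+x. (\<Sum>n. ennreal (h n x)) \<partial>M) = (\<Sum>n. \<integral>\<^sup>+x. ennreal (h n x) \<partial>M)"
    by (intro nn_integral_suminf) auto
  also have "\<dots> \<le> (\<Sum>n. ennreal ((1 / 2) ^ n))"
    by (intro suminf_le h_le) auto
  also have "\<dots> = ennreal (\<Sum>n. (1 / 2) ^ n)"
    by (intro suminf_ennreal2) (auto intro: summable_geometric)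
  also have "\<dots> < \<infinity>"
    by simp
  finally have "AE x in M. (\<Sum>n. ennreal (h n x)) \<noteq> \<infinity>"
    by (intro nn_integral_PInf_AE) auto
  then show ?thesis
  proof eventually_elim
    fix x assume "(\<Sum>n. ennreal (h n x)) \<noteq> \<infinity>"
    then have "summable (\<lambda>n. h n x)"
      by (intro summable_suminf_not_top h_nonneg) simp
    then have "(\<lambda>n. h n x) \<longlonglongrightarrow> 0"
      by (rule summable_LIMSEQ_zero)
    then have "eventually (\<lambda>n. h n x < 1) sequentially"
      by (rule order_tendstoD) simp
    then have "eventually (\<lambda>n. norm (u n x - u (Suc n) x) \<le> (1 / 2) ^ n) sequentially"
    proof eventually_elim
      fix n assume "h n x < 1"
      then have "2 ^ n * \<bar>u n x - u (Suc n) x\<bar> \<le> 1"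
        using p powr_mono2[of p 1 "2 ^ n * \<bar>u n x - u (Suc n) x\<bar>"]
        unfolding h_def by fastforce
      then show "norm (u n x - u (Suc n) x) \<le> (1 / 2) ^ n"
        by (simp add: field_simps)
    qed
    then have "summable (\<lambda>n. u n x - u (Suc n) x)"
      by (rule summable_comparison_test_ev) (simp add: summable_geometric)
    then have "convergent (\<lambda>n. \<Sum>k<n. u k x - u (Suc k) x)"
      by (simp add: summable_iff_convergent)
    then have "convergent (\<lambda>n. u 0 x - u n x)"
      by (simp only: sum_lessThan_telescope'[of "\<lambda>k. u k x"])
    then have "convergent (\<lambda>n. u 0 x - (u 0 x - u n x))"
      by (rule convergent_diff[OF convergent_const])
    then show "convergent (\<lambda>n. u n x)"
      by simp
  qed
qed

text \<open>
  Subtracting \<open>2 \<cdot> 4\<^sup>-\<^sup>m\<close> strengthens the bound enough for an induction on \<open>m\<close>.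
\<close>

lemma (in seminormed_space) nrm_minus_fast_cauchy:
  assumes u: "\<And>n. u n \<in> carrier V"
    and fast: "\<And>n. nrm V (u n \<ominus>\<^bsub>V\<^esub> u (Suc n)) \<le> (1 / 4) ^ n"
    and "n \<le> m"
  shows "nrm V (u n \<ominus>\<^bsub>V\<^esub> u m) \<le> 2 * (1 / 4) ^ n"
proof -
  have "nrm V (u n \<ominus>\<^bsub>V\<^esub> u m) \<le> 2 * (1 / 4) ^ n - 2 * (1 / 4) ^ m"
    using \<open>n \<le> m\<close>
  proof (induction m rule: dec_induct)
    case base
    show ?case
      using u by (simp add: nrm_minus_self)
  next
    case (step m)
    have "(1 / 4 :: real) ^ m \<ge> 0"
      by simp
    with step.IH nrm_minus_triangle[OF u[of n] u[of m] u[of "Suc m"]] fast[of m] show ?case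
      unfolding power_Suc by linarith
  qed
  also have "\<dots> \<le> 2 * (1 / 4) ^ n"
    by simp
  finally show ?thesis .
qed

text \<open>
  Letting \<open>m\<close> tend to infinity in \<open>\<parallel>u\<^sub>n - u\<^sub>m\<parallel> \<le> 2 \<cdot> 4\<^sup>-\<^sup>n\<close>, Fatou's lemma bounds the distance of \<open>u\<^sub>n\<close> to
  the pointwise limit. The same bound shows that the limit is of class \<open>L\<^sup>p\<close>.
\<close>

lemma Lp_functions_fast_cauchy_convergent:
  assumes p: "1 \<le> p" and u: "\<And>n. u n \<in> carrier (Lp_functions M p)"
    and fast: "\<And>n. nrm (Lp_functions M p) (\<lambda>x. u n x - u (Suc n) x) \<le> (1 / 4) ^ n"
  shows "\<exists>v\<in>carrier (Lp_functions M p).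
    (\<lambda>n. nrm (Lp_functions M p) (\<lambda>x. u n x - v x)) \<longlonglongrightarrow> 0"
proof -
  interpret seminormed_space "Lp_functions M p"
    by (rule seminormed_space_Lp_functions[OF p])
  have [measurable]: "u n \<in> borel_measurable M" for n
    using u by (simp add: in_Lp_functions_iff)
  define v where "v x = lim (\<lambda>n. u n x)" for x
  have [measurable]: "v \<in> borel_measurable M"
    unfolding v_def by measurable
  have lim: "AE x in M. (\<lambda>n. u n x) \<longlonglongrightarrow> v x"
    using Lp_functions_fast_cauchy_AE_convergent[OF p u fast]
    by eventually_elim (simp add: v_def convergent_LIMSEQ_iff)
  have dist: "(\<integral>\<^sup>+x. ennreal (\<bar>u n x - u m x\<bar> powr p) \<partial>M) \<le> ennreal ((2 * (1 / 4) ^ n) powr p)"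
    if "n \<le> m" for n m
  proof -
    have "nrm (Lp_functions M p) (\<lambda>x. u n x - u m x) \<le> 2 * (1 / 4) ^ n"
      using nrm_minus_fast_cauchy[of u n m, OF u _ that] fast
      by (simp add: Lp_functions_minus[OF p u])
    then have "(\<integral>x. \<bar>u n x - u m x\<bar> powr p \<partial>M) \<le> (2 * (1 / 4) ^ n) powr p"
      by (subst (asm) nrm_le_iff[OF p]) auto
    moreover have "integrable M (\<lambda>x. \<bar>u n x - u m x\<bar> powr p)"
      using Lp_functions_diff_closed[OF p u u, of n m] by (simp add: in_Lp_functions_iff)
    ultimately show ?thesis
      by (subst nn_integral_eq_integral) (auto simp: ennreal_leI)
  qed
  have fatou: "(\<integral>\<^sup>+x. ennreal (\<bar>u n x - v x\<bar> powr p) \<partial>M) \<le> ennreal ((2 * (1 / 4) ^ n) powr p)" for n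
  proof -
    have "(\<integral>\<^sup>+x. ennreal (\<bar>u n x - v x\<bar> powr p) \<partial>M) =
        (\<integral>\<^sup>+x. liminf (\<lambda>m. ennreal (\<bar>u n x - u m x\<bar> powr p)) \<partial>M)"
      using lim
    proof (intro nn_integral_cong_AE, eventually_elim)
      fix x assume "(\<lambda>m. u m x) \<longlonglongrightarrow> v x"
      then have "(\<lambda>m. \<bar>u n x - u m x\<bar> powr p) \<longlonglongrightarrow> \<bar>u n x - v x\<bar> powr p"
        using p by (intro tendsto_powr' tendsto_intros) auto
      then show "ennreal (\<bar>u n x - v x\<bar> powr p) = liminf (\<lambda>m. ennreal (\<bar>u n x - u m x\<bar> powr p))"
        by (intro lim_imp_Liminf[symmetric] tendsto_ennrealI) auto
    qed
    also have "\<dots> \<le> liminf (\<lambda>m. \<integral>\<^sup>+x. ennreal (\<bar>u n x - u m x\<bar> powr p) \<partial>M)"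
      by (intro nn_integral_liminf) measurable
    also have "\<dots> \<le> limsup (\<lambda>m. \<integral>\<^sup>+x. ennreal (\<bar>u n x - u m x\<bar> powr p) \<partial>M)"
      by (rule Liminf_le_Limsup) simp
    also have "\<dots> \<le> ennreal ((2 * (1 / 4) ^ n) powr p)"
      using dist[of n] by (intro Limsup_bounded) (auto simp: eventually_sequentially)
    finally show ?thesis .
  qed
  have diff: "(\<lambda>x. u n x - v x) \<in> carrier (Lp_functions M p)" for n
  proof -
    have "(\<integral>\<^sup>+x. ennreal (norm (\<bar>u n x - v x\<bar> powr p)) \<partial>M) < \<infinity>"
      using order.strict_trans1[OF fatou[of n] ennreal_less_top] by simp
    then show ?thesis
      unfolding in_Lp_functions_iff by (auto intro: integrableI_bounded)
  qed
  have nrm: "nrm (Lp_functions M p) (\<lambda>x. u n x - v x) \<le> 2 * (1 / 4) ^ n" for n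
  proof -
    have "integrable M (\<lambda>x. \<bar>u n x - v x\<bar> powr p)"
      using diff[of n] by (simp add: in_Lp_functions_iff)
    then have "(\<integral>x. \<bar>u n x - v x\<bar> powr p \<partial>M) \<le> (2 * (1 / 4) ^ n) powr p"
      using fatou[of n] by (subst (asm) nn_integral_eq_integral) auto
    then show ?thesis
      by (subst nrm_le_iff[OF p]) auto
  qed
  have "v = (\<lambda>x. u 0 x - (u 0 x - v x))"
    by simp
  then have "v \<in> carrier (Lp_functions M p)"
    using Lp_functions_diff_closed[OF p u diff, of 0 0] by simp
  moreover have "(\<lambda>n. nrm (Lp_functions M p) (\<lambda>x. u n x - v x)) \<longlonglongrightarrow> 0"
  proof (rule tendsto_sandwich[OF _ _ tendsto_const])
    show "(\<lambda>n. 2 * (1 / 4) ^ n :: real) \<longlonglongrightarrow> 0"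
      by (intro tendsto_mult_right_zero LIMSEQ_realpow_zero) auto
  qed (use nrm in \<open>auto simp: Lp_functions_nrm_nonneg\<close>)
  ultimately show ?thesis
    by blast
qed

section \<open>The spaces $L^p$ and pullbacks between them\<close>

abbreviation Lp_class :: "'a measure \<Rightarrow> real \<Rightarrow> ('a \<Rightarrow> real) \<Rightarrow> ('a \<Rightarrow> real) set"
  where "Lp_class M p u \<equiv> ae_eq_rel M p `` {u}"

context
  fixes M :: "'a measure" and p :: real
  assumes p: "1 \<le> p"
begin

lemma Lp_eq_quotient: "Lp M p = quotient_space (Lp_functions M p) (seminorm_rel (Lp_functions M p))"
  by (simp add: Lp_def ae_eq_rel_eq_seminorm_rel[OF p])

lemma real_normed_space_Lp: "real_normed_space (Lp M p)"
  unfolding Lp_eq_quotient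
  by (rule seminormed_space.real_normed_space_quotient[OF seminormed_space_Lp_functions[OF p]])

lemma seminormed_space_Lp: "seminormed_space (Lp M p)"
  by (rule real_normed_space_imp_seminormed[OF real_normed_space_Lp])

lemma carrier_Lp: "carrier (Lp M p) = Lp_class M p ` carrier (Lp_functions M p)"
  unfolding Lp_eq_quotient ae_eq_rel_eq_seminorm_rel[OF p]
  by (rule seminormed_space.carrier_quotient[OF seminormed_space_Lp_functions[OF p]])

lemma Lp_class_eqI:
  assumes "u \<in> carrier (Lp_functions M p)" "v \<in> carrier (Lp_functions M p)"
    and "AE x in M. u x = v x"
  shows "Lp_class M p u = Lp_class M p v"
proof -
  have "equiv (carrier (Lp_functions M p)) (ae_eq_rel M p)"
    unfolding ae_eq_rel_eq_seminorm_rel[OF p]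
    by (rule seminormed_space.equiv_seminorm_rel[OF seminormed_space_Lp_functions[OF p]])
  then show ?thesis
    by (rule equiv_class_eq) (use assms in \<open>simp add: ae_eq_rel_def\<close>)
qed

lemma Lp_class_add:
  assumes "u \<in> carrier (Lp_functions M p)" "v \<in> carrier (Lp_functions M p)"
  shows "Lp_class M p u \<oplus>\<^bsub>Lp M p\<^esub> Lp_class M p v = Lp_class M p (\<lambda>x. u x + v x)"
  using seminormed_space.add_quotient[OF seminormed_space_Lp_functions[OF p] assms]
  by (simp only: Lp_eq_quotient ae_eq_rel_eq_seminorm_rel[OF p] Lp_functions_simps)

lemma Lp_class_smult:
  assumes "u \<in> carrier (Lp_functions M p)"
  shows "c \<odot>\<^bsub>Lp M p\<^esub> Lp_class M p u = Lp_class M p (\<lambda>x. c * u x)"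
  using seminormed_space.smult_quotient[OF seminormed_space_Lp_functions[OF p] assms, of c]
  by (simp only: Lp_eq_quotient ae_eq_rel_eq_seminorm_rel[OF p] Lp_functions_simps)

lemma Lp_class_minus:
  assumes "u \<in> carrier (Lp_functions M p)" "v \<in> carrier (Lp_functions M p)"
  shows "Lp_class M p u \<ominus>\<^bsub>Lp M p\<^esub> Lp_class M p v = Lp_class M p (\<lambda>x. u x - v x)"
  using seminormed_space.minus_quotient[OF seminormed_space_Lp_functions[OF p] assms]
  by (simp only: Lp_eq_quotient ae_eq_rel_eq_seminorm_rel[OF p] Lp_functions_minus[OF p assms(2)])

lemma nrm_Lp_class:
  assumes "u \<in> carrier (Lp_functions M p)"
  shows "nrm (Lp M p) (Lp_class M p u) = nrm (Lp_functions M p) u"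
  using seminormed_space.nrm_quotient[OF seminormed_space_Lp_functions[OF p] assms]
  by (simp only: Lp_eq_quotient ae_eq_rel_eq_seminorm_rel[OF p])

lemma Lp_fast_cauchy_convergent:
  assumes U: "\<And>n. U n \<in> carrier (Lp M p)"
    and fast: "\<And>n. nrm (Lp M p) (U n \<ominus>\<^bsub>Lp M p\<^esub> U (Suc n)) \<le> (1 / 4) ^ n"
  shows "\<exists>V\<in>carrier (Lp M p). (\<lambda>n. nrm (Lp M p) (U n \<ominus>\<^bsub>Lp M p\<^esub> V)) \<longlonglongrightarrow> 0"
proof -
  have "\<forall>n. \<exists>u. u \<in> carrier (Lp_functions M p) \<and> U n = Lp_class M p u"
    using U unfolding carrier_Lp by blast
  then obtain u where u: "\<And>n. u n \<in> carrier (Lp_functions M p)" "\<And>n. U n = Lp_class M p (u n)"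
    by metis
  have nrm_diff: "nrm (Lp M p) (U n \<ominus>\<^bsub>Lp M p\<^esub> Lp_class M p v) =
      nrm (Lp_functions M p) (\<lambda>x. u n x - v x)" if "v \<in> carrier (Lp_functions M p)" for n v
    unfolding u(2) Lp_class_minus[OF u(1) that]
    by (rule nrm_Lp_class[OF Lp_functions_diff_closed[OF p u(1) that]])
  have "nrm (Lp_functions M p) (\<lambda>x. u n x - u (Suc n) x) \<le> (1 / 4) ^ n" for n
    using fast[of n] nrm_diff[OF u(1)] by (simp only: u(2)[of "Suc n"])
  from Lp_functions_fast_cauchy_convergent[OF p u(1) this]
  obtain v where v: "v \<in> carrier (Lp_functions M p)"
    "(\<lambda>n. nrm (Lp_functions M p) (\<lambda>x. u n x - v x)) \<longlonglongrightarrow> 0"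
    by blast
  show ?thesis
  proof (rule bexI)
    show "(\<lambda>n. nrm (Lp M p) (U n \<ominus>\<^bsub>Lp M p\<^esub> Lp_class M p v)) \<longlonglongrightarrow> 0"
      unfolding nrm_diff[OF v(1)] by (rule v(2))
    show "Lp_class M p v \<in> carrier (Lp M p)"
      unfolding carrier_Lp using v(1) by (rule imageI)
  qed
qed

end

context
  fixes M :: "'a measure" and N :: "'b measure" and \<phi> :: "'a \<Rightarrow> 'b" and p :: real
  assumes p: "1 \<le> p" and \<phi>: "\<phi> \<in> M \<rightarrow>\<^sub>M N" "distr M N \<phi> = N"
begin

lemma pullback_Lp_class:
  assumes u: "u \<in> carrier (Lp_functions N p)"
  shows "pullback M p \<phi> (Lp_class N p u) = Lp_class M p (u \<circ> \<phi>)"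
proof -
  have eq: "Lp_class M p (v \<circ> \<phi>) = Lp_class M p (u \<circ> \<phi>)" if "v \<in> Lp_class N p u" for v
  proof (rule Lp_class_eqI[OF p])
    have v: "v \<in> carrier (Lp_functions N p)" "AE x in N. u x = v x"
      using that by (auto simp: ae_eq_rel_def)
    then show "v \<circ> \<phi> \<in> carrier (Lp_functions M p)" "u \<circ> \<phi> \<in> carrier (Lp_functions M p)"
      using u by (auto intro: Lp_functions_compose[OF \<phi>])
    have "AE x in distr M N \<phi>. u x = v x"
      unfolding \<phi>(2) by (rule v(2))
    from AE_distrD[OF \<phi>(1) this] show "AE x in M. (v \<circ> \<phi>) x = (u \<circ> \<phi>) x"
      by eventually_elim simp
  qed
  have "u \<in> Lp_class N p u"
    using u by (simp add: ae_eq_rel_def)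
  then show ?thesis
    unfolding pullback_def using eq by blast
qed

lemma pullback_closed:
  assumes "U \<in> carrier (Lp N p)"
  shows "pullback M p \<phi> U \<in> carrier (Lp M p)"
  using assms unfolding carrier_Lp[OF p]
  by (auto simp only: pullback_Lp_class intro!: imageI Lp_functions_compose[OF \<phi>])

lemma nrm_pullback:
  assumes "U \<in> carrier (Lp N p)"
  shows "nrm (Lp M p) (pullback M p \<phi> U) = nrm (Lp N p) U"
  using assms unfolding carrier_Lp[OF p]
  by (auto simp only: pullback_Lp_class nrm_Lp_class[OF p] Lp_functions_compose[OF \<phi>]
      nrm_Lp_functions_compose[OF \<phi>])

lemma pullback_add:
  assumes "U \<in> carrier (Lp N p)" "V \<in> carrier (Lp N p)"
  shows "pullback M p \<phi> (U \<oplus>\<^bsub>Lp N p\<^esub> V) = pullback M p \<phi> U \<oplus>\<^bsub>Lp M p\<^esub> pullback M p \<phi> V"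
proof -
  obtain u v where uv: "u \<in> carrier (Lp_functions N p)" "v \<in> carrier (Lp_functions N p)"
    "U = Lp_class N p u" "V = Lp_class N p v"
    using assms unfolding carrier_Lp[OF p] by blast
  show ?thesis
    unfolding uv(3,4) Lp_class_add[OF p uv(1,2)] pullback_Lp_class[OF uv(1)]
      pullback_Lp_class[OF uv(2)] pullback_Lp_class[OF Lp_functions_add_closed[OF p uv(1,2)]]
      Lp_class_add[OF p Lp_functions_compose[OF \<phi> uv(1)] Lp_functions_compose[OF \<phi> uv(2)]]
    by (simp only: comp_def)
qed

lemma pullback_smult:
  assumes "U \<in> carrier (Lp N p)"
  shows "pullback M p \<phi> (c \<odot>\<^bsub>Lp N p\<^esub> U) = c \<odot>\<^bsub>Lp M p\<^esub> pullback M p \<phi> U"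
proof -
  obtain u where u: "u \<in> carrier (Lp_functions N p)" "U = Lp_class N p u"
    using assms unfolding carrier_Lp[OF p] by blast
  show ?thesis
    unfolding u(2) Lp_class_smult[OF p u(1)] pullback_Lp_class[OF u(1)]
      pullback_Lp_class[OF Lp_functions_smult_closed[OF p u(1)]]
      Lp_class_smult[OF p Lp_functions_compose[OF \<phi> u(1)]]
    by (simp only: comp_def)
qed

lemma pullback_minus:
  assumes "U \<in> carrier (Lp N p)" "V \<in> carrier (Lp N p)"
  shows "pullback M p \<phi> (U \<ominus>\<^bsub>Lp N p\<^esub> V) = pullback M p \<phi> U \<ominus>\<^bsub>Lp M p\<^esub> pullback M p \<phi> V"
  using assms
  by (simp only: seminormed_space.minus_eq_smult[OF seminormed_space_Lp[OF p]]
      pullback_closed pullback_add pullback_smult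
      seminormed_space.smult_cl[OF seminormed_space_Lp[OF p]])

end

text \<open>
  The composition law is only required on the space, since two functions that agree there have
  the same class.
\<close>

lemma pullback_pullback:
  assumes p: "1 \<le> p" and \<phi>: "\<phi> \<in> M \<rightarrow>\<^sub>M N" "distr M N \<phi> = N"
    and \<psi>: "\<psi> \<in> N \<rightarrow>\<^sub>M K" "distr N K \<psi> = K"
    and \<eta>: "\<eta> \<in> M \<rightarrow>\<^sub>M K" "distr M K \<eta> = K"
    and comp: "\<And>x. x \<in> space M \<Longrightarrow> \<psi> (\<phi> x) = \<eta> x"
    and U: "U \<in> carrier (Lp K p)"
  shows "pullback M p \<phi> (pullback N p \<psi> U) = pullback M p \<eta> U"
proof -
  obtain u where u: "u \<in> carrier (Lp_functions K p)" "U = Lp_class K p u"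
    using U unfolding carrier_Lp[OF p] by blast
  note u\<psi> = Lp_functions_compose[OF \<psi> u(1)]
  have "Lp_class M p (u \<circ> \<psi> \<circ> \<phi>) = Lp_class M p (u \<circ> \<eta>)"
    by (intro Lp_class_eqI[OF p] Lp_functions_compose[OF \<phi> u\<psi>] Lp_functions_compose[OF \<eta> u(1)] AE_I2)
       (simp add: comp)
  then show ?thesis
    unfolding u(2) pullback_Lp_class[OF p \<psi> u(1)] pullback_Lp_class[OF p \<eta> u(1)]
      pullback_Lp_class[OF p \<phi> u\<psi>] .
qed

section \<open>Cylinder functions are dense in $L^p$ of the limit\<close>

lemma (in directed_set) net_tendsto_zero_iff:
  fixes a :: "'i \<Rightarrow> real"
  assumes "\<And>i. i \<in> I \<Longrightarrow> 0 \<le> a i"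
  shows "(a \<longlongrightarrow> 0) (net I leq) \<longleftrightarrow> (\<forall>e>0. \<exists>l\<in>I. \<forall>i\<in>I. leq l i \<longrightarrow> a i < e)"
  using assms by (fastforce simp: tendsto_iff eventually_net)

lemma (in directed_set) net_nontrivial: "net I leq \<noteq> bot"
  using nonempty reflp_onD[OF refl]
  by (auto simp: trivial_limit_def eventually_net)

locale convergent_diagram = diagram I leq X \<pi>
  for I :: "'i set" and leq :: "'i \<Rightarrow> 'i \<Rightarrow> bool" and X :: "'i \<Rightarrow> 'a measure" and \<pi> +
  fixes M :: "('i \<Rightarrow> 'a) measure" and p :: real
  assumes is_limit: "is_limit I leq X \<pi> M"
    and p: "1 \<le> p"
begin

lemma space_limit: "space M = inverse_limit I leq X \<pi>"
  and sets_limit: "sets M = sigma_sets (space M)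
      {(\<lambda>x. x i) -` B \<inter> space M | i B. i \<in> I \<and> B \<in> sets (X i)}"
  and distr_proj: "i \<in> I \<Longrightarrow> distr M (X i) (\<lambda>x. x i) = X i"
  using is_limit by (simp_all add: is_limit_def)

lemma proj_in_space: "x \<in> space M \<Longrightarrow> i \<in> I \<Longrightarrow> x i \<in> space (X i)"
  by (auto simp: space_limit inverse_limit_def)

lemma bond_proj: "x \<in> space M \<Longrightarrow> i \<in> I \<Longrightarrow> j \<in> I \<Longrightarrow> leq i j \<Longrightarrow> \<pi> i j (x j) = x i"
  by (auto simp: space_limit inverse_limit_def)

lemma measurable_proj: "i \<in> I \<Longrightarrow> (\<lambda>x. x i) \<in> M \<rightarrow>\<^sub>M X i"
proof (rule measurableI)
  fix B assume "i \<in> I" "B \<in> sets (X i)"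
  then show "(\<lambda>x. x i) -` B \<inter> space M \<in> sets M"
    unfolding sets_limit by (intro sigma_sets.Basic) blast
qed (rule proj_in_space)

lemma prob_space_limit: "prob_space M"
proof -
  obtain i where "i \<in> I"
    using nonempty by blast
  then have "prob_space (distr M (X i) (\<lambda>x. x i))"
    by (simp add: distr_proj prob_space)
  with measurable_proj[OF \<open>i \<in> I\<close>] show ?thesis
    by (rule prob_space_distrD)
qed

abbreviation cylinders where
  "cylinders \<equiv> {(\<lambda>x. x i) -` B \<inter> space M | i B. i \<in> I \<and> B \<in> sets (X i)}"

text \<open>The embedding of \<open>L\<^sup>p(X\<^sub>i)\<close> into \<open>L\<^sup>p\<close> of the limit.\<close>

abbreviation P where "P i \<equiv> pullback M p (\<lambda>x. x i)"

interpretation L: seminormed_space "Lp M p"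
  by (rule seminormed_space_Lp[OF p])

lemma P_closed: "i \<in> I \<Longrightarrow> F \<in> carrier (Lp (X i) p) \<Longrightarrow> P i F \<in> carrier (Lp M p)"
  by (rule pullback_closed[OF p measurable_proj distr_proj])

lemma P_bond:
  assumes "i \<in> I" "j \<in> I" "leq i j" "F \<in> carrier (Lp (X i) p)"
  shows "P j (pullback (X j) p (\<pi> i j) F) = P i F"
  by (rule pullback_pullback[OF p measurable_proj distr_proj measurable measure_preserving
        measurable_proj distr_proj])
     (use assms in \<open>auto simp: bond_proj\<close>)

lemma bond_closed:
  assumes "i \<in> I" "j \<in> I" "leq i j" "F \<in> carrier (Lp (X i) p)"
  shows "pullback (X j) p (\<pi> i j) F \<in> carrier (Lp (X j) p)"
  using assms by (intro pullback_closed[OF p measurable measure_preserving])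

lemma nrm_minus_P:
  assumes "i \<in> I" "F \<in> carrier (Lp (X i) p)" "G \<in> carrier (Lp (X i) p)"
  shows "nrm (Lp M p) (P i F \<ominus>\<^bsub>Lp M p\<^esub> P i G) = nrm (Lp (X i) p) (F \<ominus>\<^bsub>Lp (X i) p\<^esub> G)"
proof -
  interpret Xi: seminormed_space "Lp (X i) p"
    by (rule seminormed_space_Lp[OF p])
  have "P i F \<ominus>\<^bsub>Lp M p\<^esub> P i G = P i (F \<ominus>\<^bsub>Lp (X i) p\<^esub> G)"
    using assms by (intro pullback_minus[OF p measurable_proj distr_proj, symmetric])
  then show ?thesis
    using nrm_pullback[OF p measurable_proj distr_proj, of i "F \<ominus>\<^bsub>Lp (X i) p\<^esub> G"] assms
      Xi.M.minus_closed by metis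
qed

text \<open>
  The co-Cauchy condition compares \<open>f\<^sub>i\<close> and \<open>f\<^sub>j\<close> in \<open>L\<^sup>p(X\<^sub>j)\<close>; as the embeddings are isometric
  and compatible, it can be read off in \<open>L\<^sup>p\<close> of the limit.
\<close>

lemma nrm_minus_bond:
  assumes "i \<in> I" "j \<in> I" "leq i j" "F \<in> carrier (Lp (X i) p)" "G \<in> carrier (Lp (X j) p)"
  shows "nrm (Lp (X j) p) (pullback (X j) p (\<pi> i j) F \<ominus>\<^bsub>Lp (X j) p\<^esub> G) =
    nrm (Lp M p) (P i F \<ominus>\<^bsub>Lp M p\<^esub> P j G)"
  using nrm_minus_P[OF assms(2) bond_closed[OF assms(1-4)] assms(5)] P_bond[OF assms(1-4)]
  by (simp only:)

definition approximable :: "(('i \<Rightarrow> 'a) \<Rightarrow> real) set \<Rightarrow> bool"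
  where "approximable U \<longleftrightarrow> U \<in> carrier (Lp M p) \<and>
    (\<forall>e>0. \<exists>i\<in>I. \<exists>F\<in>carrier (Lp (X i) p). nrm (Lp M p) (U \<ominus>\<^bsub>Lp M p\<^esub> P i F) < e)"

lemma approximable_P:
  assumes "i \<in> I" "F \<in> carrier (Lp (X i) p)"
  shows "approximable (P i F)"
  unfolding approximable_def
  using assms L.nrm_minus_self[OF P_closed[OF assms]] P_closed[OF assms] by metis

text \<open>Directedness brings two approximations to a common index.\<close>

lemma approximable_add:
  assumes U: "approximable U" and V: "approximable V"
  shows "approximable (U \<oplus>\<^bsub>Lp M p\<^esub> V)"
  unfolding approximable_def
proof (intro conjI allI impI)
  have UV: "U \<in> carrier (Lp M p)" "V \<in> carrier (Lp M p)"
    using U V by (simp_all add: approximable_def)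
  then show "U \<oplus>\<^bsub>Lp M p\<^esub> V \<in> carrier (Lp M p)"
    by (rule L.M.a_closed)
  fix e :: real assume "0 < e"
  then have "0 < e / 2"
    by simp
  with U obtain i F where F: "i \<in> I" "F \<in> carrier (Lp (X i) p)"
    "nrm (Lp M p) (U \<ominus>\<^bsub>Lp M p\<^esub> P i F) < e / 2"
    unfolding approximable_def by blast
  from \<open>0 < e / 2\<close> V obtain j G where G: "j \<in> I" "G \<in> carrier (Lp (X j) p)"
    "nrm (Lp M p) (V \<ominus>\<^bsub>Lp M p\<^esub> P j G) < e / 2"
    unfolding approximable_def by blast
  obtain k where k: "k \<in> I" "leq i k" "leq j k"
    using directed[OF F(1) G(1)] by blast
  interpret Xk: seminormed_space "Lp (X k) p"
    by (rule seminormed_space_Lp[OF p])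
  let ?F = "pullback (X k) p (\<pi> i k) F" and ?G = "pullback (X k) p (\<pi> j k) G"
  have FG: "?F \<in> carrier (Lp (X k) p)" "?G \<in> carrier (Lp (X k) p)"
    using F G k by (auto intro!: bond_closed)
  have P: "P k (?F \<oplus>\<^bsub>Lp (X k) p\<^esub> ?G) = P i F \<oplus>\<^bsub>Lp M p\<^esub> P j G"
    unfolding pullback_add[OF p measurable_proj[OF k(1)] distr_proj[OF k(1)] FG]
      P_bond[OF F(1) k(1,2) F(2)] P_bond[OF G(1) k(1,3) G(2)] by (rule HOL.refl)
  have "nrm (Lp M p) ((U \<oplus>\<^bsub>Lp M p\<^esub> V) \<ominus>\<^bsub>Lp M p\<^esub> P k (?F \<oplus>\<^bsub>Lp (X k) p\<^esub> ?G)) < e"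
    unfolding P using F(3) G(3)
      L.nrm_add_minus_add[OF UV P_closed[OF F(1,2)] P_closed[OF G(1,2)]] by linarith
  then show "\<exists>i\<in>I. \<exists>F\<in>carrier (Lp (X i) p).
      nrm (Lp M p) ((U \<oplus>\<^bsub>Lp M p\<^esub> V) \<ominus>\<^bsub>Lp M p\<^esub> P i F) < e"
    using k(1) Xk.M.a_closed[OF FG] by blast
qed

lemma approximable_smult:
  assumes U: "approximable U"
  shows "approximable (c \<odot>\<^bsub>Lp M p\<^esub> U)"
  unfolding approximable_def
proof (intro conjI allI impI)
  have U': "U \<in> carrier (Lp M p)"
    using U by (simp add: approximable_def)
  then show "c \<odot>\<^bsub>Lp M p\<^esub> U \<in> carrier (Lp M p)"
    by (rule L.smult_cl)
  fix e :: real assume e: "0 < e"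
  then have "0 < e / (\<bar>c\<bar> + 1)"
    by (simp add: add_nonneg_pos)
  with U obtain i F where F: "i \<in> I" "F \<in> carrier (Lp (X i) p)"
    "nrm (Lp M p) (U \<ominus>\<^bsub>Lp M p\<^esub> P i F) < e / (\<bar>c\<bar> + 1)"
    unfolding approximable_def by blast
  have "\<bar>c\<bar> * nrm (Lp M p) (U \<ominus>\<^bsub>Lp M p\<^esub> P i F) \<le> \<bar>c\<bar> * (e / (\<bar>c\<bar> + 1))"
    using F(3) by (intro mult_left_mono) auto
  also have "\<dots> < e"
    using e by (simp add: field_simps add_nonneg_pos)
  finally have "nrm (Lp M p) (c \<odot>\<^bsub>Lp M p\<^esub> U \<ominus>\<^bsub>Lp M p\<^esub> P i (c \<odot>\<^bsub>Lp (X i) p\<^esub> F)) < e"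
    unfolding pullback_smult[OF p measurable_proj[OF F(1)] distr_proj[OF F(1)] F(2)]
      L.nrm_smult_minus_smult[OF U' P_closed[OF F(1,2)]] .
  then show "\<exists>i\<in>I. \<exists>F\<in>carrier (Lp (X i) p).
      nrm (Lp M p) (c \<odot>\<^bsub>Lp M p\<^esub> U \<ominus>\<^bsub>Lp M p\<^esub> P i F) < e"
    using F(1) seminormed_space.smult_cl[OF seminormed_space_Lp[OF p] F(2), of c] by blast
qed

lemma approximable_limit:
  assumes U: "U \<in> carrier (Lp M p)" and V: "\<And>n. approximable (V n)"
    and lim: "(\<lambda>n. nrm (Lp M p) (U \<ominus>\<^bsub>Lp M p\<^esub> V n)) \<longlonglongrightarrow> 0"
  shows "approximable U"
  unfolding approximable_def
proof (intro conjI allI impI U)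
  fix e :: real assume "0 < e"
  then have e: "0 < e / 2"
    by simp
  from order_tendstoD(2)[OF lim e]
  obtain n where n: "nrm (Lp M p) (U \<ominus>\<^bsub>Lp M p\<^esub> V n) < e / 2"
    by (auto simp: eventually_sequentially)
  from V[of n] e obtain i F where F: "i \<in> I" "F \<in> carrier (Lp (X i) p)"
    "nrm (Lp M p) (V n \<ominus>\<^bsub>Lp M p\<^esub> P i F) < e / 2"
    unfolding approximable_def by blast
  have "V n \<in> carrier (Lp M p)"
    using V[of n] by (simp add: approximable_def)
  from L.nrm_minus_triangle[OF U this P_closed[OF F(1,2)]] n F(3)
  have "nrm (Lp M p) (U \<ominus>\<^bsub>Lp M p\<^esub> P i F) < e"
    by linarith
  then show "\<exists>i\<in>I. \<exists>F\<in>carrier (Lp (X i) p). nrm (Lp M p) (U \<ominus>\<^bsub>Lp M p\<^esub> P i F) < e"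
    using F(1,2) by blast
qed

lemma approximable_class_add:
  assumes "u \<in> carrier (Lp_functions M p)" "v \<in> carrier (Lp_functions M p)"
    and "approximable (Lp_class M p u)" "approximable (Lp_class M p v)"
  shows "approximable (Lp_class M p (\<lambda>x. u x + v x))"
  using approximable_add[OF assms(3,4)] unfolding Lp_class_add[OF p assms(1,2)] .

lemma approximable_class_smult:
  assumes "u \<in> carrier (Lp_functions M p)" "approximable (Lp_class M p u)"
  shows "approximable (Lp_class M p (\<lambda>x. c * u x))"
  using approximable_smult[OF assms(2), of c] unfolding Lp_class_smult[OF p assms(1)] .

text \<open>
  The approximants \<open>U\<^sub>n\<close> are dominated by \<open>u\<close>; this puts them into \<open>L\<^sup>p\<close>, and with dominated
  convergence it turns pointwise convergence into convergence in norm.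
\<close>

lemma approximable_monotone_limit:
  assumes u: "u \<in> carrier (Lp_functions M p)"
    and U: "\<And>n. U n \<in> borel_measurable M" "\<And>n x. x \<in> space M \<Longrightarrow> 0 \<le> U n x"
      "\<And>n x. x \<in> space M \<Longrightarrow> U n x \<le> u x"
      "\<And>x. x \<in> space M \<Longrightarrow> (\<lambda>n. U n x) \<longlonglongrightarrow> u x"
    and approx: "\<And>n. U n \<in> carrier (Lp_functions M p) \<Longrightarrow> approximable (Lp_class M p (U n))"
  shows "approximable (Lp_class M p u)"
proof (rule approximable_limit)
  have Un: "U n \<in> carrier (Lp_functions M p)" for n
  proof (rule Lp_functions_bounded[OF p U(1) u])
    show "\<bar>U n x\<bar> \<le> \<bar>u x\<bar>" if "x \<in> space M" for x
      using U(2,3)[OF that, of n] by linarith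
  qed
  show "approximable (Lp_class M p (U n))" for n
    by (rule approx[OF Un])
  show "Lp_class M p u \<in> carrier (Lp M p)"
    unfolding carrier_Lp[OF p] using u by (rule imageI)
  have diff: "nrm (Lp M p) (Lp_class M p u \<ominus>\<^bsub>Lp M p\<^esub> Lp_class M p (U n)) =
      nrm (Lp_functions M p) (\<lambda>x. u x - U n x)" for n
    unfolding Lp_class_minus[OF p u Un]
    by (rule nrm_Lp_class[OF p Lp_functions_diff_closed[OF p u Un]])
  show "(\<lambda>n. nrm (Lp M p) (Lp_class M p u \<ominus>\<^bsub>Lp M p\<^esub> Lp_class M p (U n))) \<longlonglongrightarrow> 0"
    unfolding diff
  proof (rule Lp_functions_dominated_convergence[OF p u])
    show "(\<lambda>x. u x - U n x) \<in> borel_measurable M" for n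
      using u U(1) by (auto simp: in_Lp_functions_iff)
    show "\<bar>u x - U n x\<bar> \<le> \<bar>u x\<bar>" if "x \<in> space M" for n x
      using U(2,3)[OF that, of n] by linarith
    show "(\<lambda>n. u x - U n x) \<longlonglongrightarrow> 0" if "x \<in> space M" for x
      using tendsto_diff[OF tendsto_const U(4)[OF that], of "u x"] by simp
  qed
qed

lemma indicator_in_Lp_functions:
  assumes "prob_space N" "A \<in> sets N"
  shows "indicator A \<in> carrier (Lp_functions N p)"
proof -
  interpret prob_space N by fact
  have "integrable N (\<lambda>x. \<bar>indicator A x :: real\<bar> powr p)"
    by (rule integrable_const_bound[where B = 1]) (use assms in \<open>auto simp: indicator_def\<close>)
  then show ?thesis
    using assms by (simp add: in_Lp_functions_iff)
qed

lemma approximable_cylinder: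
  assumes "i \<in> I" "B \<in> sets (X i)"
  shows "approximable (Lp_class M p (indicator ((\<lambda>x. x i) -` B \<inter> space M)))"
proof -
  note B = indicator_in_Lp_functions[OF prob_space[OF assms(1)] assms(2)]
  have "P i (Lp_class (X i) p (indicator B)) = Lp_class M p (indicator B \<circ> (\<lambda>x. x i))"
    by (rule pullback_Lp_class[OF p measurable_proj[OF assms(1)] distr_proj[OF assms(1)] B])
  also have "\<dots> = Lp_class M p (indicator ((\<lambda>x. x i) -` B \<inter> space M))"
    by (intro Lp_class_eqI[OF p]
          Lp_functions_compose[OF measurable_proj[OF assms(1)] distr_proj[OF assms(1)] B]
          indicator_in_Lp_functions[OF prob_space_limit]
          measurable_sets[OF measurable_proj[OF assms(1)] assms(2)] AE_I2)
       (simp add: indicator_def)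
  finally show ?thesis
    using approximable_P[OF assms(1), of "Lp_class (X i) p (indicator B)"] B
    by (simp add: carrier_Lp[OF p] del: Image_singleton_iff)
qed

text \<open>
  By directedness two cylinders are cylinders over a common index.
\<close>

lemma Int_stable_cylinders:
  "Int_stable cylinders"
proof (rule Int_stableI)
  fix A B
  assume "A \<in> cylinders"
    and "B \<in> cylinders"
  then obtain i C j D where C: "i \<in> I" "C \<in> sets (X i)" "A = (\<lambda>x. x i) -` C \<inter> space M"
    and D: "j \<in> I" "D \<in> sets (X j)" "B = (\<lambda>x. x j) -` D \<inter> space M"
    by blast
  obtain k where k: "k \<in> I" "leq i k" "leq j k"
    using directed[OF C(1) D(1)] by blast
  let ?E = "(\<pi> i k -` C \<inter> space (X k)) \<inter> (\<pi> j k -` D \<inter> space (X k))"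
  have "?E \<in> sets (X k)"
    using measurable_sets[OF measurable[OF C(1) k(1,2)] C(2)]
      measurable_sets[OF measurable[OF D(1) k(1,3)] D(2)] by (rule sets.Int)
  moreover have "A \<inter> B = (\<lambda>x. x k) -` ?E \<inter> space M"
    using C D k by (auto simp: bond_proj proj_in_space)
  ultimately show "A \<inter> B \<in> cylinders"
    using k(1) by blast
qed

text \<open>
  The sets with approximable indicator form a Dynkin system: complements correspond to
  differences from \<open>1\<close>, finite disjoint unions to sums, and countable disjoint unions to monotone
  limits of these. Intersections would correspond to products, which approximation in \<open>L\<^sup>p\<close> does
  not control; this is why stability of the generator under intersection is used.
\<close>

lemma approximable_indicator:
  assumes "A \<in> sets M"
  shows "approximable (Lp_class M p (indicator A))"
proof -
  note ind = indicator_in_Lp_functions[OF prob_space_limit]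
  obtain i where i: "i \<in> I"
    using nonempty by blast
  have space: "approximable (Lp_class M p (indicator (space M)))"
  proof -
    have "(\<lambda>x. x i) -` space (X i) \<inter> space M = space M"
      using proj_in_space[OF _ i] by blast
    with approximable_cylinder[OF i sets.top] show ?thesis
      by (simp only:)
  qed
  have A: "A \<in> sigma_sets (space M) cylinders"
    using assms by (simp only: sets_limit)
  have "cylinders \<subseteq> Pow (space M)"
    by blast
  from Int_stable_cylinders this A show ?thesis
  proof (induction rule: sigma_sets_induct_disjoint)
    case (basic A)
    then show ?case
      using approximable_cylinder by auto
  next
    case empty
    show ?case
      using approximable_cylinder[OF i sets.empty_sets] by (simp only: vimage_empty Int_empty_left)
  next
    case (compl A)
    then have A: "A \<in> sets M"
      by (simp only: sets_limit)
    have "approximable (Lp_class M p (\<lambda>x. indicator (space M) x + (-1) * indicator A x))"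
      by (intro approximable_class_add approximable_class_smult Lp_functions_smult_closed[OF p]
            ind A sets.top space compl.IH)
    moreover have "(\<lambda>x. indicator (space M) x + (-1) * indicator A x) =
        (indicator (space M - A) :: _ \<Rightarrow> real)"
      using sets.sets_into_space[OF A] by (auto simp: fun_eq_iff indicator_def)
    ultimately show ?case
      by (simp only:)
  next
    case (union A)
    have A: "A n \<in> sets M" for n
      using union.hyps(2) by (auto simp only: sets_limit)
    have fin: "approximable (Lp_class M p (indicator (\<Union>k<n. A k)))" for n
    proof (induction n)
      case 0
      show ?case
        using approximable_cylinder[OF i sets.empty_sets]
        by (simp only: vimage_empty Int_empty_left lessThan_0 Union_empty image_empty)
    next
      case (Suc n)
      have "approximable (Lp_class M p (\<lambda>x. indicator (\<Union>k<n. A k) x + indicator (A n) x))"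
        by (intro approximable_class_add ind A Suc.IH union.IH sets.countable_UN') (auto intro: A)
      moreover have "(\<lambda>x. indicator (\<Union>k<n. A k) x + indicator (A n) x) =
          (indicator (\<Union>k<Suc n. A k) :: _ \<Rightarrow> real)"
      proof -
        have "A k \<inter> A n = {}" if "k < n" for k
          using disjoint_family_onD[OF union.hyps(1), of k n] that by simp
        then show ?thesis
          by (auto simp: fun_eq_iff indicator_def less_Suc_eq)
      qed
      ultimately show ?case
        by (simp only:)
    qed
    show ?case
    proof (rule approximable_monotone_limit[where U = "\<lambda>n. indicator (\<Union>k<n. A k)"])
      show "indicator (\<Union>k. A k) \<in> carrier (Lp_functions M p)"
        using A by (intro ind) auto
      show "indicator (\<Union>k<n. A k) \<in> borel_measurable M" for n
        using A by (intro borel_measurable_indicator) auto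
      show "(\<lambda>n. indicator (\<Union>k<n. A k) x :: real) \<longlonglongrightarrow> indicator (\<Union>k. A k) x" for x
        by (rule LIMSEQ_indicator_UN)
    qed (auto simp: fin indicator_def simp del: Image_singleton_iff)
  qed
qed

lemma approximable_nonneg:
  assumes "u \<in> borel_measurable M" "\<And>x. 0 \<le> u x" "u \<in> carrier (Lp_functions M p)"
  shows "approximable (Lp_class M p u)"
  using assms
proof (induction rule: borel_measurable_induct_real)
  case (set A)
  then show ?case
    by (intro approximable_indicator)
next
  case (mult u c)
  show ?case
  proof (cases "c = 0")
    case True
    have "approximable (Lp_class M p (\<lambda>x. 0 * indicator (space M) x))"
      by (intro approximable_class_smult approximable_indicator indicator_in_Lp_functions
            prob_space_limit sets.top)
    then show ?thesis
      using True by (simp only: mult_zero_left)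
  next
    case False
    with Lp_functions_smult_closed[OF p mult.prems, of "1 / c"]
    have "u \<in> carrier (Lp_functions M p)"
      by simp
    then show ?thesis
      by (intro approximable_class_smult mult.IH)
  qed
next
  case (add u v)
  have "u \<in> carrier (Lp_functions M p)"
    by (rule Lp_functions_bounded[OF p add.hyps(1) add.prems]) (simp add: add.hyps)
  moreover have "v \<in> carrier (Lp_functions M p)"
    by (rule Lp_functions_bounded[OF p add.hyps(3) add.prems]) (simp add: add.hyps)
  ultimately show ?case
    by (intro approximable_class_add add.IH)
next
  case (seq U)
  show ?case
  proof (rule approximable_monotone_limit[OF seq.prems, where U = U])
    show "U n x \<le> u x" if "x \<in> space M" for n x
      using incseq_le[OF _ seq.hyps(4)[OF that]] seq.hyps(3) by (auto simp: incseq_def le_fun_def)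
  qed (use seq in blast)+
qed

lemma approximable_Lp:
  assumes "U \<in> carrier (Lp M p)"
  shows "approximable U"
proof -
  obtain u where u: "u \<in> carrier (Lp_functions M p)" "U = Lp_class M p u"
    using assms unfolding carrier_Lp[OF p] by blast
  define v w where "v x = max (u x) 0" and "w x = max (- u x) 0" for x
  have [measurable]: "u \<in> borel_measurable M"
    using u by (simp add: in_Lp_functions_iff)
  have meas: "v \<in> borel_measurable M" "w \<in> borel_measurable M"
    unfolding v_def w_def by measurable
  have v: "v \<in> carrier (Lp_functions M p)" and w: "w \<in> carrier (Lp_functions M p)"
    by (rule Lp_functions_bounded[OF p _ u(1)], rule meas, simp add: v_def w_def)+
  have "approximable (Lp_class M p (\<lambda>x. v x + (-1) * w x))"
    using meas
    by (intro approximable_class_add approximable_class_smult approximable_nonneg v w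
          Lp_functions_smult_closed[OF p]) (auto simp: v_def w_def)
  moreover have "(\<lambda>x. v x + (-1) * w x) = u"
    by (auto simp: v_def w_def fun_eq_iff)
  ultimately show ?thesis
    by (simp only: u(2))
qed

section \<open>Co-Cauchy families converge in $L^p$ of the limit\<close>

text \<open>
  If \<open>U\<close> has positive distance from the range of \<open>P\<^sub>i\<close>, some element of the range is closer than
  twice the distance. The factor 2 spares the question whether the distance is attained.
\<close>

lemma nearly_best_approximation:
  assumes i: "i \<in> I" and U: "U \<in> carrier (Lp M p)"
  shows "\<exists>F\<in>carrier (Lp (X i) p). \<forall>G\<in>carrier (Lp (X i) p).
    nrm (Lp M p) (P i F \<ominus>\<^bsub>Lp M p\<^esub> U) \<le> 2 * nrm (Lp M p) (P i G \<ominus>\<^bsub>Lp M p\<^esub> U)"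
proof -
  interpret Li: seminormed_space "Lp (X i) p"
    by (rule seminormed_space_Lp[OF p])
  define d where "d F = nrm (Lp M p) (P i F \<ominus>\<^bsub>Lp M p\<^esub> U)" for F
  define S where "S = d ` carrier (Lp (X i) p)"
  have d_nonneg: "0 \<le> d F" if "F \<in> carrier (Lp (X i) p)" for F
    unfolding d_def by (intro L.nrm_nonneg L.M.minus_closed P_closed i that U)
  have "S \<noteq> {}"
    unfolding S_def using Li.M.zero_closed by blast
  have bdd: "bdd_below S"
    unfolding S_def using d_nonneg by (intro bdd_belowI2)
  have "\<exists>F\<in>carrier (Lp (X i) p). \<forall>G\<in>carrier (Lp (X i) p). d F \<le> 2 * d G"
  proof (cases "0 < Inf S")
    case True
    then have "Inf S < 2 * Inf S"
      by simp
    then obtain F where F: "F \<in> carrier (Lp (X i) p)" "d F < 2 * Inf S"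
      using cInf_lessD[OF \<open>S \<noteq> {}\<close>] unfolding S_def by blast
    have "d F \<le> 2 * d G" if "G \<in> carrier (Lp (X i) p)" for G
    proof -
      have "Inf S \<le> d G"
        using bdd that by (intro cInf_lower) (simp_all add: S_def)
      then show ?thesis
        using F(2) by simp
    qed
    then show ?thesis
      using F(1) by blast
  next
    case False
    \<comment> \<open>At distance zero a minimiser exists because \<open>L\<^sup>p(X\<^sub>i)\<close> is complete: points
      within \<open>4\<^sup>-\<^sup>n / 2\<close> of \<open>U\<close> have mutual distances that suit the convergence criterion.\<close>
    have "\<exists>F\<in>carrier (Lp (X i) p). d F < (1 / 4) ^ n / 2" for n
    proof -
      have "Inf S < (1 / 4) ^ n / 2"
        using False by (intro le_less_trans[of "Inf S" 0]) auto
      then show ?thesis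
        using cInf_lessD[OF \<open>S \<noteq> {}\<close>] unfolding S_def by blast
    qed
    then obtain F where F: "\<And>n. F n \<in> carrier (Lp (X i) p)" "\<And>n. d (F n) < (1 / 4) ^ n / 2"
      by metis
    have PF: "P i (F n) \<in> carrier (Lp M p)" for n
      by (rule P_closed[OF i F(1)])
    have "nrm (Lp (X i) p) (F n \<ominus>\<^bsub>Lp (X i) p\<^esub> F (Suc n)) \<le> (1 / 4) ^ n" for n
    proof -
      have "nrm (Lp (X i) p) (F n \<ominus>\<^bsub>Lp (X i) p\<^esub> F (Suc n)) =
          nrm (Lp M p) (P i (F n) \<ominus>\<^bsub>Lp M p\<^esub> P i (F (Suc n)))"
        by (rule nrm_minus_P[OF i F(1) F(1), symmetric])
      also have "\<dots> \<le> d (F n) + d (F (Suc n))"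
        using L.nrm_minus_triangle[OF PF U PF, of n "Suc n"]
          L.nrm_minus_commute[OF U PF, of "Suc n"] by (simp only: d_def)
      also have "\<dots> \<le> (1 / 4) ^ n"
        using F(2)[of n] F(2)[of "Suc n"] zero_le_power[of "1 / 4 :: real" n]
        unfolding power_Suc by linarith
      finally show ?thesis .
    qed
    from Lp_fast_cauchy_convergent[OF p F(1) this]
    obtain G where G: "G \<in> carrier (Lp (X i) p)"
      "(\<lambda>n. nrm (Lp (X i) p) (F n \<ominus>\<^bsub>Lp (X i) p\<^esub> G)) \<longlonglongrightarrow> 0"
      by blast
    have "(\<lambda>n. nrm (Lp (X i) p) (F n \<ominus>\<^bsub>Lp (X i) p\<^esub> G) + (1 / 4) ^ n / 2) \<longlonglongrightarrow> 0 + 0 / 2"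
      by (intro tendsto_intros G(2) LIMSEQ_realpow_zero) auto
    moreover have "d G \<le> nrm (Lp (X i) p) (F n \<ominus>\<^bsub>Lp (X i) p\<^esub> G) + (1 / 4) ^ n / 2" for n
      using L.nrm_minus_triangle[OF P_closed[OF i G(1)] PF U, of n]
        L.nrm_minus_commute[OF P_closed[OF i G(1)] PF, of n] nrm_minus_P[OF i F(1) G(1), of n] F(2)[of n]
      unfolding d_def by linarith
    ultimately have "d G \<le> 0 + 0 / 2"
      by (intro LIMSEQ_le_const) auto
    then have "d G \<le> 2 * d H" if "H \<in> carrier (Lp (X i) p)" for H
      using d_nonneg[OF that] by simp
    then show ?thesis
      using G(1) by blast
  qed
  then show ?thesis
    unfolding d_def .
qed

text \<open>
  Every co-Cauchy family is studied through the limit of its image in \<open>L\<^sup>p(M)\<close>.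
\<close>

definition represents :: "('i \<Rightarrow> ('a \<Rightarrow> real) set) \<Rightarrow> (('i \<Rightarrow> 'a) \<Rightarrow> real) set \<Rightarrow> bool"
  where "represents f U \<longleftrightarrow>
    f \<in> (\<Pi>\<^sub>E i\<in>I. carrier (Lp (X i) p)) \<and> U \<in> carrier (Lp M p) \<and>
    ((\<lambda>i. nrm (Lp M p) (P i (f i) \<ominus>\<^bsub>Lp M p\<^esub> U)) \<longlongrightarrow> 0) (net I leq)"

lemma eventually_net_mem: "(\<And>i. i \<in> I \<Longrightarrow> Q i) \<Longrightarrow> eventually Q (net I leq)"
  using nonempty by (auto simp: eventually_net)

lemma P_family_closed:
  "f \<in> (\<Pi>\<^sub>E i\<in>I. carrier (Lp (X i) p)) \<Longrightarrow> i \<in> I \<Longrightarrow> P i (f i) \<in> carrier (Lp M p)"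
  using P_closed PiE_mem[of f I "\<lambda>i. carrier (Lp (X i) p)" i] by blast

lemma represents_iff:
  assumes "f \<in> (\<Pi>\<^sub>E i\<in>I. carrier (Lp (X i) p))" "U \<in> carrier (Lp M p)"
  shows "represents f U \<longleftrightarrow> (\<forall>e>0. \<exists>l\<in>I. \<forall>i\<in>I. leq l i \<longrightarrow>
    nrm (Lp M p) (P i (f i) \<ominus>\<^bsub>Lp M p\<^esub> U) < e)"
proof -
  have "0 \<le> nrm (Lp M p) (P i (f i) \<ominus>\<^bsub>Lp M p\<^esub> U)" if "i \<in> I" for i
    by (rule L.nrm_nonneg[OF L.M.minus_closed[OF P_family_closed[OF assms(1) that] assms(2)]])
  then show ?thesis
    unfolding represents_def using assms by (simp only: net_tendsto_zero_iff simp_thms)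
qed

lemma co_cauchy_iff:
  "co_cauchy I leq X \<pi> p f \<longleftrightarrow> f \<in> (\<Pi>\<^sub>E i\<in>I. carrier (Lp (X i) p)) \<and>
    (\<forall>e>0. \<exists>l\<in>I. \<forall>i\<in>I. \<forall>j\<in>I. leq l i \<longrightarrow> leq i j \<longrightarrow>
      nrm (Lp M p) (P i (f i) \<ominus>\<^bsub>Lp M p\<^esub> P j (f j)) < e)"
proof -
  have "nrm (Lp (X j) p) (pullback (X j) p (\<pi> i j) (f i) \<ominus>\<^bsub>Lp (X j) p\<^esub> f j) =
      nrm (Lp M p) (P i (f i) \<ominus>\<^bsub>Lp M p\<^esub> P j (f j))"
    if "f \<in> (\<Pi>\<^sub>E i\<in>I. carrier (Lp (X i) p))" "i \<in> I" "j \<in> I" "leq i j" for i j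
    by (rule nrm_minus_bond[OF that(2-4) PiE_mem[OF that(1,2)] PiE_mem[OF that(1,3)]])
  then show ?thesis
    unfolding co_cauchy_def by (auto 0 3)
qed

lemma represents_unique:
  assumes "represents f U" "represents f V"
  shows "U = V"
proof -
  have UV: "U \<in> carrier (Lp M p)" "V \<in> carrier (Lp M p)" "f \<in> (\<Pi>\<^sub>E i\<in>I. carrier (Lp (X i) p))"
    using assms by (simp_all only: represents_def)
  have "((\<lambda>i. nrm (Lp M p) (P i (f i) \<ominus>\<^bsub>Lp M p\<^esub> U) + nrm (Lp M p) (P i (f i) \<ominus>\<^bsub>Lp M p\<^esub> V))
      \<longlongrightarrow> 0 + 0) (net I leq)"
    using assms by (intro tendsto_add) (simp_all only: represents_def)
  moreover have "eventually (\<lambda>i. nrm (Lp M p) (U \<ominus>\<^bsub>Lp M p\<^esub> V) \<le>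
      nrm (Lp M p) (P i (f i) \<ominus>\<^bsub>Lp M p\<^esub> U) + nrm (Lp M p) (P i (f i) \<ominus>\<^bsub>Lp M p\<^esub> V)) (net I leq)"
  proof (rule eventually_net_mem)
    fix i assume "i \<in> I"
    note Pf = P_family_closed[OF UV(3) this]
    show "nrm (Lp M p) (U \<ominus>\<^bsub>Lp M p\<^esub> V) \<le>
        nrm (Lp M p) (P i (f i) \<ominus>\<^bsub>Lp M p\<^esub> U) + nrm (Lp M p) (P i (f i) \<ominus>\<^bsub>Lp M p\<^esub> V)"
      using L.nrm_minus_triangle[OF UV(1) Pf UV(2)] L.nrm_minus_commute[OF UV(1) Pf] by linarith
  qed
  ultimately have "nrm (Lp M p) (U \<ominus>\<^bsub>Lp M p\<^esub> V) \<le> 0 + 0"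
    using net_nontrivial by (rule tendsto_lowerbound)
  then have "nrm (Lp M p) (U \<ominus>\<^bsub>Lp M p\<^esub> V) = 0"
    using L.nrm_nonneg[OF L.M.minus_closed[OF UV(1,2)]] by linarith
  then have "U \<ominus>\<^bsub>Lp M p\<^esub> V = \<zero>\<^bsub>Lp M p\<^esub>"
    using real_normed_space.nrm_eq_zero_iff[OF real_normed_space_Lp[OF p]
        L.M.minus_closed[OF UV(1,2)]] by blast
  then show ?thesis
    using L.minus_eq_zero_iff[OF UV(1,2)] by blast
qed

lemma represents_tendsto_nrm:
  assumes "represents f U"
  shows "((\<lambda>i. nrm (Lp (X i) p) (f i)) \<longlongrightarrow> nrm (Lp M p) U) (net I leq)"
proof -
  have fU: "f \<in> (\<Pi>\<^sub>E i\<in>I. carrier (Lp (X i) p))" "U \<in> carrier (Lp M p)"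
    and lim: "((\<lambda>i. nrm (Lp M p) (P i (f i) \<ominus>\<^bsub>Lp M p\<^esub> U)) \<longlongrightarrow> 0) (net I leq)"
    using assms by (simp_all only: represents_def)
  have "((\<lambda>i. nrm (Lp (X i) p) (f i) - nrm (Lp M p) U) \<longlongrightarrow> 0) (net I leq)"
  proof (rule Lim_null_comparison[OF eventually_net_mem lim])
    fix i assume i: "i \<in> I"
    have "nrm (Lp (X i) p) (f i) = nrm (Lp M p) (P i (f i))"
      by (rule nrm_pullback[OF p measurable_proj[OF i] distr_proj[OF i] PiE_mem[OF fU(1) i], symmetric])
    then show "norm (nrm (Lp (X i) p) (f i) - nrm (Lp M p) U) \<le> nrm (Lp M p) (P i (f i) \<ominus>\<^bsub>Lp M p\<^esub> U)"
      using L.nrm_diff_le[OF P_family_closed[OF fU(1) i] fU(2)] by (simp only: real_norm_def)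
  qed
  then show ?thesis
    by (rule LIM_zero_cancel)
qed

lemma represents_imp_co_cauchy:
  assumes "represents f U"
  shows "co_cauchy I leq X \<pi> p f"
  unfolding co_cauchy_iff
proof (intro conjI allI impI)
  have fU: "f \<in> (\<Pi>\<^sub>E i\<in>I. carrier (Lp (X i) p))" "U \<in> carrier (Lp M p)"
    using assms by (simp_all only: represents_def)
  then show "f \<in> (\<Pi>\<^sub>E i\<in>I. carrier (Lp (X i) p))"
    by blast
  fix e :: real assume "0 < e"
  then have "0 < e / 2"
    by simp
  then obtain l where l: "l \<in> I"
    "\<And>i. i \<in> I \<Longrightarrow> leq l i \<Longrightarrow> nrm (Lp M p) (P i (f i) \<ominus>\<^bsub>Lp M p\<^esub> U) < e / 2"
    using assms unfolding represents_iff[OF fU] by blast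
  have "nrm (Lp M p) (P i (f i) \<ominus>\<^bsub>Lp M p\<^esub> P j (f j)) < e"
    if ij: "i \<in> I" "j \<in> I" "leq l i" "leq i j" for i j
  proof -
    have "leq l j"
      by (rule transp_onD[OF trans l(1) ij])
    note Pf = P_family_closed[OF fU(1) ij(1)] P_family_closed[OF fU(1) ij(2)]
    show ?thesis
      using L.nrm_minus_triangle[OF Pf(1) fU(2) Pf(2)] L.nrm_minus_commute[OF fU(2) Pf(2)]
        l(2)[OF ij(1,3)] l(2)[OF ij(2) \<open>leq l j\<close>] by linarith
  qed
  then show "\<exists>l\<in>I. \<forall>i\<in>I. \<forall>j\<in>I. leq l i \<longrightarrow> leq i j \<longrightarrow>
      nrm (Lp M p) (P i (f i) \<ominus>\<^bsub>Lp M p\<^esub> P j (f j)) < e"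
    using l(1) by blast
qed

text \<open>
  A net in a complete space is tested along an increasing sequence of indices at which the
  oscillation is below \<open>4\<^sup>-\<^sup>n\<close>; the limit of that sequence is the limit of the net.
\<close>

lemma co_cauchy_imp_represents:
  assumes "co_cauchy I leq X \<pi> p f"
  shows "\<exists>U. represents f U"
proof -
  have f: "f \<in> (\<Pi>\<^sub>E i\<in>I. carrier (Lp (X i) p))"
    using assms by (simp only: co_cauchy_def)
  note Pf = P_family_closed[OF f]
  have "\<exists>l\<in>I. \<forall>i\<in>I. \<forall>j\<in>I. leq l i \<longrightarrow> leq i j \<longrightarrow>
      nrm (Lp M p) (P i (f i) \<ominus>\<^bsub>Lp M p\<^esub> P j (f j)) < (1 / 4) ^ n" for n
    using assms unfolding co_cauchy_iff by simp
  then obtain l where l: "\<And>n. l n \<in> I"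
    "\<And>n i j. i \<in> I \<Longrightarrow> j \<in> I \<Longrightarrow> leq (l n) i \<Longrightarrow> leq i j \<Longrightarrow>
      nrm (Lp M p) (P i (f i) \<ominus>\<^bsub>Lp M p\<^esub> P j (f j)) < (1 / 4) ^ n"
    by metis
  have "\<exists>k. \<forall>n. (k n \<in> I \<and> leq (l n) (k n)) \<and> leq (k n) (k (Suc n))"
  proof (rule dependent_nat_choice)
    show "\<exists>k. k \<in> I \<and> leq (l 0) k"
      using directed[OF l(1) l(1)] by blast
    show "\<exists>k'. (k' \<in> I \<and> leq (l (Suc n)) k') \<and> leq k k'" if "k \<in> I \<and> leq (l n) k" for k n
      using directed[of k "l (Suc n)"] that l(1) by blast
  qed
  then obtain k where k: "\<And>n. k n \<in> I" "\<And>n. leq (l n) (k n)" "\<And>n. leq (k n) (k (Suc n))"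
    by blast
  have "nrm (Lp M p) (P (k n) (f (k n)) \<ominus>\<^bsub>Lp M p\<^esub> P (k (Suc n)) (f (k (Suc n)))) \<le> (1 / 4) ^ n" for n
    by (rule less_imp_le[OF l(2)[OF k(1) k(1) k(2) k(3)]])
  from Lp_fast_cauchy_convergent[OF p, of "\<lambda>n. P (k n) (f (k n))", OF Pf[OF k(1)] this]
  obtain U where U: "U \<in> carrier (Lp M p)"
    "(\<lambda>n. nrm (Lp M p) (P (k n) (f (k n)) \<ominus>\<^bsub>Lp M p\<^esub> U)) \<longlonglongrightarrow> 0"
    by blast
  have "represents f U"
    unfolding represents_iff[OF f U(1)]
  proof (intro allI impI)
    fix e :: real assume "0 < e"
    then have e: "0 < e / 2"
      by simp
    have "(\<lambda>n. (1 / 4 :: real) ^ n) \<longlonglongrightarrow> 0"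
      by (rule LIMSEQ_realpow_zero) auto
    from eventually_conj[OF order_tendstoD(2)[OF this e] order_tendstoD(2)[OF U(2) e]]
    obtain n where n: "(1 / 4) ^ n < e / 2"
      "nrm (Lp M p) (P (k n) (f (k n)) \<ominus>\<^bsub>Lp M p\<^esub> U) < e / 2"
      by (auto simp only: eventually_sequentially)
    have "nrm (Lp M p) (P i (f i) \<ominus>\<^bsub>Lp M p\<^esub> U) < e" if "i \<in> I" "leq (k n) i" for i
      using L.nrm_minus_triangle[OF Pf[OF that(1)] Pf[OF k(1)] U(1), of n]
        L.nrm_minus_commute[OF Pf[OF that(1)] Pf[OF k(1)], of n]
        l(2)[OF k(1) that(1) k(2) that(2)] n by linarith
    then show "\<exists>l\<in>I. \<forall>i\<in>I. leq l i \<longrightarrow> nrm (Lp M p) (P i (f i) \<ominus>\<^bsub>Lp M p\<^esub> U) < e"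
      using k(1) by blast
  qed
  then show ?thesis
    by blast
qed

text \<open>
  By density some \<open>P\<^sub>l G\<close> is close to \<open>U\<close>. For \<open>i \<ge> l\<close> it also lies in the range of \<open>P\<^sub>i\<close>, so the nearly
  best approximation chosen there is at most twice as far away.
\<close>

lemma ex_represents:
  assumes U: "U \<in> carrier (Lp M p)"
  shows "\<exists>f. represents f U"
proof -
  have "\<forall>i\<in>I. \<exists>F. F \<in> carrier (Lp (X i) p) \<and> (\<forall>G\<in>carrier (Lp (X i) p).
      nrm (Lp M p) (P i F \<ominus>\<^bsub>Lp M p\<^esub> U) \<le> 2 * nrm (Lp M p) (P i G \<ominus>\<^bsub>Lp M p\<^esub> U))"
    using nearly_best_approximation[OF _ U] by blast
  from bchoice[OF this] obtain f where f: "\<And>i. i \<in> I \<Longrightarrow> f i \<in> carrier (Lp (X i) p)"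
    "\<And>i G. i \<in> I \<Longrightarrow> G \<in> carrier (Lp (X i) p) \<Longrightarrow>
      nrm (Lp M p) (P i (f i) \<ominus>\<^bsub>Lp M p\<^esub> U) \<le> 2 * nrm (Lp M p) (P i G \<ominus>\<^bsub>Lp M p\<^esub> U)"
    by blast
  have fam: "restrict f I \<in> (\<Pi>\<^sub>E i\<in>I. carrier (Lp (X i) p))"
    by (intro restrict_PiE_iff[THEN iffD2] ballI f(1))
  have "represents (restrict f I) U"
    unfolding represents_iff[OF fam U]
  proof (intro allI impI)
    fix e :: real assume "0 < e"
    then have "0 < e / 2"
      by simp
    then obtain l G where G: "l \<in> I" "G \<in> carrier (Lp (X l) p)"
      "nrm (Lp M p) (U \<ominus>\<^bsub>Lp M p\<^esub> P l G) < e / 2"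
      using approximable_Lp[OF U] unfolding approximable_def by blast
    have "nrm (Lp M p) (P i (restrict f I i) \<ominus>\<^bsub>Lp M p\<^esub> U) < e" if i: "i \<in> I" "leq l i" for i
    proof -
      have "nrm (Lp M p) (P i (f i) \<ominus>\<^bsub>Lp M p\<^esub> U) \<le> 2 * nrm (Lp M p) (P l G \<ominus>\<^bsub>Lp M p\<^esub> U)"
        using f(2)[OF i(1) bond_closed[OF G(1) i(1,2) G(2)]] unfolding P_bond[OF G(1) i(1,2) G(2)] .
      then show ?thesis
        using G(3) L.nrm_minus_commute[OF U P_closed[OF G(1,2)]] i(1)
        unfolding restrict_apply'[OF i(1)] by linarith
    qed
    then show "\<exists>l\<in>I. \<forall>i\<in>I. leq l i \<longrightarrow> nrm (Lp M p) (P i (restrict f I i) \<ominus>\<^bsub>Lp M p\<^esub> U) < e"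
      using G(1) by blast
  qed
  then show ?thesis
    by blast
qed

section \<open>The space of co-Cauchy families\<close>

abbreviation families where "families \<equiv> co_cauchy_families I leq X \<pi> p"

lemma families_simps:
  "\<zero>\<^bsub>families\<^esub> = (\<lambda>i\<in>I. \<zero>\<^bsub>Lp (X i) p\<^esub>)"
  "f \<oplus>\<^bsub>families\<^esub> g = (\<lambda>i\<in>I. f i \<oplus>\<^bsub>Lp (X i) p\<^esub> g i)"
  "c \<odot>\<^bsub>families\<^esub> f = (\<lambda>i\<in>I. c \<odot>\<^bsub>Lp (X i) p\<^esub> f i)"
  "nrm families f = Lim (net I leq) (\<lambda>i. nrm (Lp (X i) p) (f i))"
  by (simp_all add: co_cauchy_families_def)

text \<open>
  This description of co-Cauchy families makes closure under the vector space operations a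
  matter of adding and scaling limits.
\<close>

lemma carrier_families: "f \<in> carrier families \<longleftrightarrow> (\<exists>U. represents f U)"
  using represents_imp_co_cauchy co_cauchy_imp_represents
  by (auto simp: co_cauchy_families_def)

lemma nrm_families: "represents f U \<Longrightarrow> nrm families f = nrm (Lp M p) U"
  unfolding families_simps by (rule tendsto_Lim[OF net_nontrivial represents_tendsto_nrm])

lemma represents_add:
  assumes "represents f U" "represents g V"
  shows "represents (f \<oplus>\<^bsub>families\<^esub> g) (U \<oplus>\<^bsub>Lp M p\<^esub> V)"
proof -
  have UV: "f \<in> (\<Pi>\<^sub>E i\<in>I. carrier (Lp (X i) p))" "U \<in> carrier (Lp M p)"
      "g \<in> (\<Pi>\<^sub>E i\<in>I. carrier (Lp (X i) p))" "V \<in> carrier (Lp M p)"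
    and lim: "((\<lambda>i. nrm (Lp M p) (P i (f i) \<ominus>\<^bsub>Lp M p\<^esub> U)) \<longlongrightarrow> 0) (net I leq)"
      "((\<lambda>i. nrm (Lp M p) (P i (g i) \<ominus>\<^bsub>Lp M p\<^esub> V)) \<longlongrightarrow> 0) (net I leq)"
    using assms by (simp_all only: represents_def)
  have sum: "f i \<oplus>\<^bsub>Lp (X i) p\<^esub> g i \<in> carrier (Lp (X i) p)" if "i \<in> I" for i
  proof -
    interpret Li: seminormed_space "Lp (X i) p"
      by (rule seminormed_space_Lp[OF p])
    show ?thesis
      by (rule Li.M.a_closed[OF PiE_mem[OF UV(1) that] PiE_mem[OF UV(3) that]])
  qed
  show ?thesis
    unfolding represents_def families_simps
  proof (intro conjI restrict_PiE_iff[THEN iffD2] ballI sum L.M.a_closed[OF UV(2,4)])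
    show "((\<lambda>i. nrm (Lp M p) (P i ((\<lambda>i\<in>I. f i \<oplus>\<^bsub>Lp (X i) p\<^esub> g i) i)
        \<ominus>\<^bsub>Lp M p\<^esub> (U \<oplus>\<^bsub>Lp M p\<^esub> V))) \<longlongrightarrow> 0) (net I leq)"
    proof (rule Lim_null_comparison[OF eventually_net_mem tendsto_add_zero[OF lim]])
      fix i assume i: "i \<in> I"
      note Pf = P_family_closed[OF UV(1) i] P_family_closed[OF UV(3) i]
      have "P i (f i \<oplus>\<^bsub>Lp (X i) p\<^esub> g i) = P i (f i) \<oplus>\<^bsub>Lp M p\<^esub> P i (g i)"
        by (rule pullback_add[OF p measurable_proj[OF i] distr_proj[OF i]
              PiE_mem[OF UV(1) i] PiE_mem[OF UV(3) i]])
      then show "norm (nrm (Lp M p) (P i ((\<lambda>i\<in>I. f i \<oplus>\<^bsub>Lp (X i) p\<^esub> g i) i)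
          \<ominus>\<^bsub>Lp M p\<^esub> (U \<oplus>\<^bsub>Lp M p\<^esub> V))) \<le>
          nrm (Lp M p) (P i (f i) \<ominus>\<^bsub>Lp M p\<^esub> U) + nrm (Lp M p) (P i (g i) \<ominus>\<^bsub>Lp M p\<^esub> V)"
        using L.nrm_add_minus_add[OF Pf UV(2,4)]
          L.nrm_nonneg[OF L.M.minus_closed[OF L.M.a_closed[OF Pf] L.M.a_closed[OF UV(2,4)]]]
        by (simp only: restrict_apply'[OF i] real_norm_def abs_of_nonneg)
    qed
  qed
qed

lemma represents_smult:
  assumes "represents f U"
  shows "represents (c \<odot>\<^bsub>families\<^esub> f) (c \<odot>\<^bsub>Lp M p\<^esub> U)"
proof -
  have fU: "f \<in> (\<Pi>\<^sub>E i\<in>I. carrier (Lp (X i) p))" "U \<in> carrier (Lp M p)"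
    and lim: "((\<lambda>i. nrm (Lp M p) (P i (f i) \<ominus>\<^bsub>Lp M p\<^esub> U)) \<longlongrightarrow> 0) (net I leq)"
    using assms by (simp_all only: represents_def)
  have prod: "c \<odot>\<^bsub>Lp (X i) p\<^esub> f i \<in> carrier (Lp (X i) p)" if "i \<in> I" for i
    by (rule seminormed_space.smult_cl[OF seminormed_space_Lp[OF p] PiE_mem[OF fU(1) that]])
  show ?thesis
    unfolding represents_def families_simps
  proof (intro conjI restrict_PiE_iff[THEN iffD2] ballI prod L.smult_cl[OF fU(2)])
    show "((\<lambda>i. nrm (Lp M p) (P i ((\<lambda>i\<in>I. c \<odot>\<^bsub>Lp (X i) p\<^esub> f i) i)
        \<ominus>\<^bsub>Lp M p\<^esub> (c \<odot>\<^bsub>Lp M p\<^esub> U))) \<longlongrightarrow> 0) (net I leq)"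
    proof (rule Lim_null_comparison[OF eventually_net_mem tendsto_mult_right_zero[OF lim]])
      fix i assume i: "i \<in> I"
      note Pf = P_family_closed[OF fU(1) i]
      have "P i (c \<odot>\<^bsub>Lp (X i) p\<^esub> f i) = c \<odot>\<^bsub>Lp M p\<^esub> P i (f i)"
        by (rule pullback_smult[OF p measurable_proj[OF i] distr_proj[OF i] PiE_mem[OF fU(1) i]])
      then show "norm (nrm (Lp M p) (P i ((\<lambda>i\<in>I. c \<odot>\<^bsub>Lp (X i) p\<^esub> f i) i)
          \<ominus>\<^bsub>Lp M p\<^esub> (c \<odot>\<^bsub>Lp M p\<^esub> U))) \<le> \<bar>c\<bar> * nrm (Lp M p) (P i (f i) \<ominus>\<^bsub>Lp M p\<^esub> U)"
        using L.nrm_smult_minus_smult[OF Pf fU(2), of c] L.nrm_nonneg[OF L.M.minus_closed[OF Pf fU(2)]]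
        by (simp only: restrict_apply'[OF i] real_norm_def abs_mult abs_of_nonneg abs_idempotent order_refl)
    qed
  qed
qed

lemma families_mem:
  assumes "f \<in> carrier families"
  shows "f \<in> (\<Pi>\<^sub>E i\<in>I. carrier (Lp (X i) p))"
  using assms unfolding carrier_families represents_def by blast

lemma families_ext:
  assumes "f \<in> carrier families" "g \<in> carrier families" "\<And>i. i \<in> I \<Longrightarrow> f i = g i"
  shows "f = g"
  by (rule PiE_ext[OF families_mem[OF assms(1)] families_mem[OF assms(2)] assms(3)])

lemma families_zero_smult:
  assumes "f \<in> carrier families"
  shows "0 \<odot>\<^bsub>families\<^esub> f = \<zero>\<^bsub>families\<^esub>"
  unfolding families_simps
  by (intro restrict_ext seminormed_space.smult_zero_left[OF seminormed_space_Lp[OF p]]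
        PiE_mem[OF families_mem[OF assms]])

text \<open>
  The zero family is \<open>0\<close> times any co-Cauchy family, for instance one that represents \<open>0\<close>.
\<close>

lemma families_closed:
  "f \<in> carrier families \<Longrightarrow> g \<in> carrier families \<Longrightarrow> f \<oplus>\<^bsub>families\<^esub> g \<in> carrier families"
  "f \<in> carrier families \<Longrightarrow> c \<odot>\<^bsub>families\<^esub> f \<in> carrier families"
  "\<zero>\<^bsub>families\<^esub> \<in> carrier families"
proof -
  show "f \<oplus>\<^bsub>families\<^esub> g \<in> carrier families" if "f \<in> carrier families" "g \<in> carrier families" for f g
    using that represents_add unfolding carrier_families by blast
  show *: "c \<odot>\<^bsub>families\<^esub> f \<in> carrier families" if "f \<in> carrier families" for c f
    using that represents_smult unfolding carrier_families by blast
  obtain f where "f \<in> carrier families"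
    using ex_represents[OF L.M.zero_closed] unfolding carrier_families by blast
  from *[OF this, of 0] families_zero_smult[OF this]
  show "\<zero>\<^bsub>families\<^esub> \<in> carrier families"
    by (simp only:)
qed

lemma seminormed_space_families: "seminormed_space families"
proof (rule seminormed_spaceI)
  fix f g h assume fgh: "f \<in> carrier families" "g \<in> carrier families" "h \<in> carrier families"
  show "(f \<oplus>\<^bsub>families\<^esub> g) \<oplus>\<^bsub>families\<^esub> h = f \<oplus>\<^bsub>families\<^esub> (g \<oplus>\<^bsub>families\<^esub> h)"
  proof (rule families_ext)
    fix i assume i: "i \<in> I"
    interpret Li: seminormed_space "Lp (X i) p"
      by (rule seminormed_space_Lp[OF p])
    show "((f \<oplus>\<^bsub>families\<^esub> g) \<oplus>\<^bsub>families\<^esub> h) i = (f \<oplus>\<^bsub>families\<^esub> (g \<oplus>\<^bsub>families\<^esub> h)) i"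
      unfolding families_simps restrict_apply'[OF i]
      by (intro Li.M.a_assoc fgh[THEN families_mem, THEN PiE_mem] i)
  qed (intro families_closed fgh)+
next
  fix f g assume fg: "f \<in> carrier families" "g \<in> carrier families"
  show "f \<oplus>\<^bsub>families\<^esub> g = g \<oplus>\<^bsub>families\<^esub> f"
  proof (rule families_ext)
    fix i assume i: "i \<in> I"
    interpret Li: seminormed_space "Lp (X i) p"
      by (rule seminormed_space_Lp[OF p])
    show "(f \<oplus>\<^bsub>families\<^esub> g) i = (g \<oplus>\<^bsub>families\<^esub> f) i"
      unfolding families_simps restrict_apply'[OF i]
      by (intro Li.M.a_comm fg[THEN families_mem, THEN PiE_mem] i)
  qed (intro families_closed fg)+
  show "c \<odot>\<^bsub>families\<^esub> (f \<oplus>\<^bsub>families\<^esub> g) = c \<odot>\<^bsub>families\<^esub> f \<oplus>\<^bsub>families\<^esub> c \<odot>\<^bsub>families\<^esub> g" for c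
  proof (rule families_ext)
    fix i assume i: "i \<in> I"
    show "(c \<odot>\<^bsub>families\<^esub> (f \<oplus>\<^bsub>families\<^esub> g)) i = (c \<odot>\<^bsub>families\<^esub> f \<oplus>\<^bsub>families\<^esub> c \<odot>\<^bsub>families\<^esub> g) i"
      unfolding families_simps restrict_apply'[OF i]
      by (intro seminormed_space.smult_add_right[OF seminormed_space_Lp[OF p]]
            fg[THEN families_mem, THEN PiE_mem] i)
  qed (intro families_closed fg)+
  obtain U V where UV: "represents f U" "represents g V"
    using fg unfolding carrier_families by blast
  then have "U \<in> carrier (Lp M p)" "V \<in> carrier (Lp M p)"
    by (simp_all only: represents_def)
  then show "nrm families (f \<oplus>\<^bsub>families\<^esub> g) \<le> nrm families f + nrm families g"
    unfolding nrm_families[OF represents_add[OF UV]] nrm_families[OF UV(1)] nrm_families[OF UV(2)]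
    by (rule L.nrm_triangle)
next
  fix f assume f: "f \<in> carrier families"
  show "\<zero>\<^bsub>families\<^esub> \<oplus>\<^bsub>families\<^esub> f = f"
  proof (rule families_ext)
    fix i assume i: "i \<in> I"
    interpret Li: seminormed_space "Lp (X i) p"
      by (rule seminormed_space_Lp[OF p])
    show "(\<zero>\<^bsub>families\<^esub> \<oplus>\<^bsub>families\<^esub> f) i = f i"
      unfolding families_simps restrict_apply'[OF i]
      by (intro Li.M.l_zero f[THEN families_mem, THEN PiE_mem] i)
  qed (intro families_closed f)+
  show "(a + b) \<odot>\<^bsub>families\<^esub> f = a \<odot>\<^bsub>families\<^esub> f \<oplus>\<^bsub>families\<^esub> b \<odot>\<^bsub>families\<^esub> f" for a b
  proof (rule families_ext)
    fix i assume i: "i \<in> I"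
    show "((a + b) \<odot>\<^bsub>families\<^esub> f) i = (a \<odot>\<^bsub>families\<^esub> f \<oplus>\<^bsub>families\<^esub> b \<odot>\<^bsub>families\<^esub> f) i"
      unfolding families_simps restrict_apply'[OF i]
      by (intro seminormed_space.smult_add_left[OF seminormed_space_Lp[OF p]]
            f[THEN families_mem, THEN PiE_mem] i)
  qed (intro families_closed f)+
  show "(a * b) \<odot>\<^bsub>families\<^esub> f = a \<odot>\<^bsub>families\<^esub> (b \<odot>\<^bsub>families\<^esub> f)" for a b
  proof (rule families_ext)
    fix i assume i: "i \<in> I"
    show "((a * b) \<odot>\<^bsub>families\<^esub> f) i = (a \<odot>\<^bsub>families\<^esub> (b \<odot>\<^bsub>families\<^esub> f)) i"
      unfolding families_simps restrict_apply'[OF i]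
      by (intro seminormed_space.smult_smult[OF seminormed_space_Lp[OF p]]
            f[THEN families_mem, THEN PiE_mem] i)
  qed (intro families_closed f)+
  show "1 \<odot>\<^bsub>families\<^esub> f = f"
  proof (rule families_ext)
    fix i assume i: "i \<in> I"
    show "(1 \<odot>\<^bsub>families\<^esub> f) i = f i"
      unfolding families_simps restrict_apply'[OF i]
      by (intro seminormed_space.smult_one_left[OF seminormed_space_Lp[OF p]]
            f[THEN families_mem, THEN PiE_mem] i)
  qed (intro families_closed f)+
  obtain U where U: "represents f U"
    using f unfolding carrier_families by blast
  then have "U \<in> carrier (Lp M p)"
    by (simp only: represents_def)
  then show "nrm families (c \<odot>\<^bsub>families\<^esub> f) = \<bar>c\<bar> * nrm families f" for c
    unfolding nrm_families[OF represents_smult[OF U]] nrm_families[OF U]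
    by (rule L.nrm_smult)
qed (intro families_closed families_zero_smult; assumption)+

text \<open>
  The norms of the differences \<open>f\<^sub>i - g\<^sub>i\<close> converge, and their limit is the seminorm of \<open>f - g\<close>.
\<close>

lemma asymptotic_rel_eq_seminorm_rel: "asymptotic_rel I leq X \<pi> p = seminorm_rel families"
proof -
  have "((\<lambda>i. nrm (Lp (X i) p) (f i \<ominus>\<^bsub>Lp (X i) p\<^esub> g i)) \<longlongrightarrow> 0) (net I leq) \<longleftrightarrow>
      nrm families (f \<ominus>\<^bsub>families\<^esub> g) = 0"
    if fg: "f \<in> carrier families" "g \<in> carrier families" for f g
  proof -
    have minus: "f \<ominus>\<^bsub>families\<^esub> g = f \<oplus>\<^bsub>families\<^esub> (-1) \<odot>\<^bsub>families\<^esub> g"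
      by (rule seminormed_space.minus_eq_smult[OF seminormed_space_families fg(2)])
    have "(f \<ominus>\<^bsub>families\<^esub> g) i = f i \<ominus>\<^bsub>Lp (X i) p\<^esub> g i" if i: "i \<in> I" for i
      unfolding minus families_simps restrict_apply'[OF i]
      by (rule seminormed_space.minus_eq_smult[OF seminormed_space_Lp[OF p]
            PiE_mem[OF families_mem[OF fg(2)] i], symmetric])
    then have cong: "((\<lambda>i. nrm (Lp (X i) p) (f i \<ominus>\<^bsub>Lp (X i) p\<^esub> g i)) \<longlongrightarrow> 0) (net I leq) \<longleftrightarrow>
        ((\<lambda>i. nrm (Lp (X i) p) ((f \<ominus>\<^bsub>families\<^esub> g) i)) \<longlongrightarrow> 0) (net I leq)"
      by (intro tendsto_cong eventually_net_mem) (simp only:)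
    obtain U where U: "represents (f \<ominus>\<^bsub>families\<^esub> g) U"
      using families_closed(1)[OF fg(1) families_closed(2)[OF fg(2), of "-1"]]
      unfolding minus carrier_families by blast
    note lim = represents_tendsto_nrm[OF U, folded nrm_families[OF U]]
    have "((\<lambda>i. nrm (Lp (X i) p) ((f \<ominus>\<^bsub>families\<^esub> g) i)) \<longlongrightarrow> 0) (net I leq) \<longleftrightarrow>
        nrm families (f \<ominus>\<^bsub>families\<^esub> g) = 0"
    proof
      assume "((\<lambda>i. nrm (Lp (X i) p) ((f \<ominus>\<^bsub>families\<^esub> g) i)) \<longlongrightarrow> 0) (net I leq)"
      with lim show "nrm families (f \<ominus>\<^bsub>families\<^esub> g) = 0"
        by (rule tendsto_unique[OF net_nontrivial])
    next
      assume "nrm families (f \<ominus>\<^bsub>families\<^esub> g) = 0"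
      with lim show "((\<lambda>i. nrm (Lp (X i) p) ((f \<ominus>\<^bsub>families\<^esub> g) i)) \<longlongrightarrow> 0) (net I leq)"
        by (simp only:)
    qed
    then show ?thesis
      unfolding cong .
  qed
  moreover have "co_cauchy I leq X \<pi> p f \<longleftrightarrow> f \<in> carrier families" for f
    by (simp add: co_cauchy_families_def)
  ultimately show ?thesis
    unfolding asymptotic_rel_def seminorm_rel_def by blast
qed

text \<open>
  Sending a co-Cauchy family to the element that it represents is linear, isometric and onto.
\<close>

theorem isometrically_isomorphic_LLp: "isometrically_isomorphic (Lp M p) (LLp I leq X \<pi> p)"
  unfolding LLp_def asymptotic_rel_eq_seminorm_rel
proof (rule seminormed_space.isometrically_isomorphic_quotient[OF seminormed_space_families
      real_normed_space_Lp[OF p]])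
  define S where "S f = (THE U. represents f U)" for f
  have S: "S f = U" if "represents f U" for f U
    unfolding S_def using that by (rule the_equality) (rule represents_unique[OF _ that])
  show "S ` carrier families = carrier (Lp M p)"
  proof (intro subset_antisym subsetI)
    fix U assume "U \<in> S ` carrier families"
    then obtain f where f: "U = S f" "f \<in> carrier families"
      by (rule imageE)
    then obtain V where "represents f V"
      unfolding carrier_families by blast
    with S[OF this] f(1) show "U \<in> carrier (Lp M p)"
      by (simp only: represents_def)
  next
    fix U assume "U \<in> carrier (Lp M p)"
    then obtain f where f: "represents f U"
      using ex_represents by blast
    then have "f \<in> carrier families"
      unfolding carrier_families by blast
    with S[OF f, symmetric] show "U \<in> S ` carrier families"
      by (rule image_eqI)
  qed
  fix f assume "f \<in> carrier families"
  then obtain U where U: "represents f U"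
    unfolding carrier_families by blast
  show "S (c \<odot>\<^bsub>families\<^esub> f) = c \<odot>\<^bsub>Lp M p\<^esub> S f" for c
    unfolding S[OF U] by (rule S[OF represents_smult[OF U]])
  show "nrm (Lp M p) (S f) = nrm families f"
    unfolding S[OF U] by (rule nrm_families[OF U, symmetric])
  fix g assume "g \<in> carrier families"
  then obtain V where V: "represents g V"
    unfolding carrier_families by blast
  show "S (f \<oplus>\<^bsub>families\<^esub> g) = S f \<oplus>\<^bsub>Lp M p\<^esub> S g"
    unfolding S[OF U] S[OF V] by (rule S[OF represents_add[OF U V]])
qed

end

theorem theorem3p2:
  fixes I :: "'i set" and leq :: "'i \<Rightarrow> 'i \<Rightarrow> bool"
    and X :: "'i \<Rightarrow> 'a measure" and \<pi> :: "'i \<Rightarrow> 'i \<Rightarrow> 'a \<Rightarrow> 'a"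
    and M :: "('i \<Rightarrow> 'a) measure" and p :: real
  assumes "diagram I leq X \<pi>"
    and "is_limit I leq X \<pi> M"
    and "1 \<le> p"
  shows "isometrically_isomorphic (Lp M p) (LLp I leq X \<pi> p)"
proof -
  interpret convergent_diagram I leq X \<pi> M p
    using assms by (simp add: convergent_diagram_def convergent_diagram_axioms_def)
  show ?thesis
    by (rule isometrically_isomorphic_LLp)
qed

end
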